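(* Fix an integer $\ell \ge 1$. Let $\mathbf{u} \in L^2(\mathbb{R})$ (complex-valued) with $\|\mathbf{u}\|_{L^2} = 1$, and suppose that for some $q > 1/2$ we have $|\hat{\mathbf{u}}(s)| = \mathcal{O}(|s|^{-q})$ as $|s| \to \infty$, i.e. there is $M>0$ with $|\hat{\mathbf{u}}(s)| \le M |s|^{-q}$ for all $|s|$ sufficiently large. For each $n \ge \ell$ let $\mathbf{y}_{\mathrm{DPLR}}$ and $\mathbf{y}_{\mathrm{Diag}}$ be the outputs of the size-$n$ systems $\Sigma_{\mathrm{DPLR}}$ and $\Sigma_{\mathrm{Diag}}$ (defined in the context) with input $\mathbf{u}$ and zero initial state. Then $$ \|\mathbf{y}_{\mathrm{DPLR}} - \mathbf{y}_{\mathrm{Diag}}\|_{L^2} = \mathcal{O}(n^{-1})\sqrt{\ell} \qquad \text{as } n \to \infty, $$ i.e. there is a constant $K$ depending only on $q$ and $M$ such that $\|\mathbf{y}_{\mathrm{DPLR}} - \mathbf{y}_{\mathrm{Diag}}\|_{L^2} \le K\sqrt{\ell}\, n^{-1}$ for all sufficiently large $n$. Moreover, for every fixed $q' > 1/2$, the constant $K$ can be chosen independent of $q$ as long as $q \in [q', \infty)$.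
   Context: For each $n\ge 1$ define the real $n \times n$ matrix $\mathbf{A}_H$ and the column vector $\mathbf{B}_H \in \mathbb{R}^n$ (HiPPO-LegS) by $(A_H)_{jk} = -\sqrt{2j-1}\sqrt{2k-1}$ if $j>k$, $(A_H)_{jj} = -j$, $(A_H)_{jk}=0$ if $j<k$; and $(B_H)_j = \sqrt{(2j-1)/2}$. Define $\mathbf{A}_H^\perp = \mathbf{A}_H + \mathbf{B}_H\mathbf{B}_H^\top$; explicitly, $(A_H^\perp)_{jk} = -\tfrac12\sqrt{2j-1}\sqrt{2k-1}$ if $j>k$, $(A_H^\perp)_{jj} = -\tfrac12$, $(A_H^\perp)_{jk} = \tfrac12\sqrt{2j-1}\sqrt{2k-1}$ if $j<k$. This matrix is normal; write $\mathbf{A}_H^\perp = \mathbf{V}_H \boldsymbol{\Lambda}_H \mathbf{V}_H^{-1}$ with $\mathbf{V}_H$ unitary and $\boldsymbol{\Lambda}_H$ diagonal. The DPLR system $\Sigma_{\mathrm{DPLR}}$ has $\mathbf{A}_{\mathrm{DPLR}} = \boldsymbol{\Lambda}_H - \mathbf{V}_H^{-1}\mathbf{B}_H\mathbf{B}_H^\top\mathbf{V}_H$ $(= \mathbf{V}_H^{-1}\mathbf{A}_H\mathbf{V}_H)$, $\mathbf{B}_{\mathrm{DPLR}} = \mathbf{V}_H^{-1}\mathbf{B}_H$. The diagonal system $\Sigma_{\mathrm{Diag}}$ has $\mathbf{A}_{\mathrm{Diag}} = \boldsymbol{\Lambda}_H$, $\mathbf{B}_{\mathrm{Diag}} = \tfrac12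 \mathbf{V}_H^{-1}\mathbf{B}_H$. For $n \ge \ell$ both have output matrix $\mathbf{C}_{\mathrm{DPLR}} = \mathbf{C}_{\mathrm{Diag}} = \mathbf{e}_\ell^\top \mathbf{V}_H$, where $\mathbf{e}_\ell$ is the $\ell$th standard basis vector, and a common scalar $\mathbf{D}_{\mathrm{DPLR}} = \mathbf{D}_{\mathrm{Diag}} \in \mathbb{C}$. A system $(\mathbf{A},\mathbf{B},\mathbf{C},\mathbf{D})$ is the linear time-invariant system $\mathbf{x}'(t) = \mathbf{A}\mathbf{x}(t)+\mathbf{B}\mathbf{u}(t)$, $\mathbf{y}(t) = \mathbf{C}\mathbf{x}(t)+\mathbf{D}\mathbf{u}(t)$. Its transfer function is $G(s) = \mathbf{C}(s\mathbf{I}-\mathbf{A})^{-1}\mathbf{B}+\mathbf{D}$. All systems here are asymptotically stable (eigenvalues of $\mathbf{A}$ in the open left half-plane), and the map from input $\mathbf{u}$ to output $\mathbf{y}$ (with zero initial state) is understood as $\hat{\mathbf{y}}(s) = G(is)\hat{\mathbf{u}}(s)$, $s\in\mathbb{R}$, where $\hat{\ }$ is the Fourier transform $\hat f(s) = \int_{\mathbb{R}} f(t)e^{-ist}\,dt$ extended to $L^2(\mathbb{R})$. *)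

theory Defs
  imports "HOL-Analysis.Analysis" "Jordan_Normal_Form.Schur_Decomposition"
begin

(* Square-integrable functions on the real line, represented by Borel functions. *)

definition L2 :: "(real \<Rightarrow> complex) set" where
  "L2 = {f \<in> borel_measurable lborel. integrable lborel (\<lambda>t. (cmod (f t))\<^sup>2)}"

definition L2_norm :: "(real \<Rightarrow> complex) \<Rightarrow> real" where
  "L2_norm f = sqrt (LINT t|lborel. (cmod (f t))\<^sup>2)"

definition fourier :: "(real \<Rightarrow> complex) \<Rightarrow> real \<Rightarrow> complex" where
  "fourier f s = (LINT t|lborel. f t * exp (- (\<i> * complex_of_real s * complex_of_real t)))"

(* The extension of the Fourier transform to L2 by continuity, as a relation between functions:
   its graph is the closure in L2 \<times> L2 of the graph of the integral transform on
   L1 \<inter> L2. The value g is determined up to a null set only. By Plancherel, the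
   condition that fourier (\<phi> k) lies in L2 holds automatically; it is there because the
   Bochner integral in L2_norm is 0 for functions that are not square-integrable. *)
definition fourier_L2 :: "(real \<Rightarrow> complex) \<Rightarrow> (real \<Rightarrow> complex) \<Rightarrow> bool" where
  "fourier_L2 f g \<longleftrightarrow> f \<in> L2 \<and> g \<in> L2 \<and>
     (\<exists>\<phi> :: nat \<Rightarrow> real \<Rightarrow> complex.
        (\<forall>k. integrable lborel (\<phi> k) \<and> \<phi> k \<in> L2 \<and> fourier (\<phi> k) \<in> L2) \<and>
        (\<lambda>k. L2_norm (\<lambda>t. \<phi> k t - f t)) \<longlonglongrightarrow> 0 \<and>
        (\<lambda>k. L2_norm (\<lambda>s. fourier (\<phi> k) s - g s)) \<longlonglongrightarrow> 0)"

(* The decay condition |u^(s)| = O(|s|^(-q)) with constant M; u^ is a class of functions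
   modulo null sets, so the pointwise bound is imposed almost everywhere. *)
definition fourier_decay :: "real \<Rightarrow> real \<Rightarrow> (real \<Rightarrow> complex) \<Rightarrow> bool" where
  "fourier_decay q M u \<longleftrightarrow>
     (\<exists>uhat S. fourier_L2 u uhat \<and>
        (AE s in lborel. S \<le> \<bar>s\<bar> \<longrightarrow> cmod (uhat s) \<le> M * \<bar>s\<bar> powr (- q)))"

abbreviation minv :: "complex mat \<Rightarrow> complex mat" where
  "minv A \<equiv> the (mat_inverse A)"

(* Single-input single-output systems: B is a column, C a row (both as matrices), D a scalar. *)
definition transfer ::
  "complex mat \<Rightarrow> complex mat \<Rightarrow> complex mat \<Rightarrow> complex \<Rightarrow> complex \<Rightarrow> complex" where
  "transfer A B C D s = (C * minv (s \<cdot>\<^sub>m 1\<^sub>m (dim_row A) - A) * B) $$ (0, 0) + D"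

definition system_output ::
  "complex mat \<Rightarrow> complex mat \<Rightarrow> complex mat \<Rightarrow> complex
     \<Rightarrow> (real \<Rightarrow> complex) \<Rightarrow> (real \<Rightarrow> complex) \<Rightarrow> bool" where
  "system_output A B C D u y \<longleftrightarrow>
     (\<exists>uhat. fourier_L2 u uhat \<and>
        fourier_L2 y (\<lambda>s. transfer A B C D (\<i> * complex_of_real s) * uhat s))"

(* The HiPPO-LegS matrices. Matrix indices start at 0, so row i here is row j = i + 1 in the
   usual formulas and 2 j - 1 becomes 2 i + 1. *)

definition A_H :: "nat \<Rightarrow> real mat" where
  "A_H n = mat n n (\<lambda>(i, k).
     if k < i then - (sqrt (2 * real i + 1) * sqrt (2 * real k + 1))
     else if i = k then - (real i + 1)
     else 0)"

definition B_H :: "nat \<Rightarrow> real mat" where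
  "B_H n = mat n 1 (\<lambda>(i, _). sqrt ((2 * real i + 1) / 2))"

definition A_H_perp :: "nat \<Rightarrow> real mat" where
  "A_H_perp n = A_H n + B_H n * transpose_mat (B_H n)"

lemma A_H_perp_explicit:
  "A_H_perp n = mat n n (\<lambda>(i, k).
     if k < i then - (sqrt (2 * real i + 1) * sqrt (2 * real k + 1)) / 2
     else if i = k then - 1 / 2
     else sqrt (2 * real i + 1) * sqrt (2 * real k + 1) / 2)"
  by (rule eq_matI)
    (auto simp: A_H_perp_def A_H_def B_H_def scalar_prod_def real_sqrt_divide field_simps)

abbreviation B_Hc :: "nat \<Rightarrow> complex mat" where
  "B_Hc n \<equiv> map_mat complex_of_real (B_H n)"

definition unitary_mat :: "nat \<Rightarrow> complex mat \<Rightarrow> bool" where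
  "unitary_mat n V \<longleftrightarrow> V \<in> carrier_mat n n \<and>
     V * mat_adjoint V = 1\<^sub>m n \<and> mat_adjoint V * V = 1\<^sub>m n"

(* V and \<Lambda> are not unique, so statements quantify over all such pairs. *)
definition diagonalizes_A_H_perp :: "nat \<Rightarrow> complex mat \<Rightarrow> complex mat \<Rightarrow> bool" where
  "diagonalizes_A_H_perp n V \<Lambda> \<longleftrightarrow>
     unitary_mat n V \<and> \<Lambda> \<in> carrier_mat n n \<and> diagonal_mat \<Lambda> \<and>
     map_mat complex_of_real (A_H_perp n) = V * \<Lambda> * minv V"

definition A_DPLR :: "nat \<Rightarrow> complex mat \<Rightarrow> complex mat \<Rightarrow> complex mat" where
  "A_DPLR n V \<Lambda> = \<Lambda> - minv V * B_Hc n * transpose_mat (B_Hc n) * V"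

definition B_DPLR :: "nat \<Rightarrow> complex mat \<Rightarrow> complex mat" where
  "B_DPLR n V = minv V * B_Hc n"

definition A_Diag :: "complex mat \<Rightarrow> complex mat" where
  "A_Diag \<Lambda> = \<Lambda>"

definition B_Diag :: "nat \<Rightarrow> complex mat \<Rightarrow> complex mat" where
  "B_Diag n V = (1 / 2) \<cdot>\<^sub>m (minv V * B_Hc n)"

(* The row l-th unit vector (1 <= l <= n, counted from 1) times V. *)
definition C_out :: "nat \<Rightarrow> nat \<Rightarrow> complex mat \<Rightarrow> complex mat" where
  "C_out n l V = mat_of_rows n [unit_vec n (l - 1)] * V"

end

theory Submission
  imports Defs "HOL-Probability.Characteristic_Functions"
begin

text \<open>
  Let \<open>p(s) = \<Prod>\<^bsub>k<n\<^esub> (s - k)/(s + k + 1)\<close>. The triangular system \<open>(s - A_H) x = B_H\<close> is solved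
  explicitly by \<open>x\<^sub>i = \<surd>(2i+1) p\<^sub>i(s) / (\<surd>2 (s + i + 1))\<close>, with \<open>p\<^sub>i\<close> the product of the first \<open>i\<close> factors,
  and it satisfies \<open>B_H\<^sup>T x = (1 - p)/2\<close>. Since \<open>A_H_perp\<close> is a rank one perturbation of \<open>A_H\<close>,
  the two transfer functions are \<open>x\<^sub>l\<close> and \<open>x\<^sub>l/(1 + p)\<close> up to the common constant, and
  \<open>g = B_H\<^sup>T (s - A_H_perp)\<^sup>-\<^sup>1 B_H = (1 - p)/(1 + p)\<close>. On the imaginary axis
  \<open>\<bar>p\<bar>\<^sup>2 = \<omega>\<^sup>2/(\<omega>\<^sup>2 + n\<^sup>2)\<close> and \<open>Re g = (1 - \<bar>p\<bar>\<^sup>2)/\<bar>1 + p\<bar>\<^sup>2\<close>, so the squared difference is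
  \<open>\<bar>x\<^sub>l\<bar>\<^sup>2 (\<omega>\<^sup>2/n\<^sup>2) Re g \<le> (l/n\<^sup>2) Re g\<close>, and it remains to bound the integral of \<open>Re g \<bar>v\<bar>\<^sup>2\<close>,
  with \<open>v\<close> the Fourier transform of the input, independently of \<open>n\<close>.
  For \<open>\<bar>\<omega>\<bar> \<le> n\<close> the weight \<open>Re g\<close> is at most 6. For larger \<open>\<bar>\<omega>\<bar>\<close> it has high peaks, but \<open>g\<close> is a sum of simple fractions with poles on \<open>Re s = -1/2\<close> and nonnegative residues,
  so a Poisson kernel estimate gives \<open>\<integral>\<^bsub>[-W,W]\<^esub> Re g \<le> 25 W g(W) \<le> 25 W\<close> for positive integers
  \<open>W\<close>; summing over dyadic \<open>W\<close> against the decay \<open>\<bar>\<omega>\<bar>\<^sup>-\<^sup>2\<^sup>q\<close> converges since \<open>2q > 1\<close>.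
  Plancherel's theorem converts the bound into one for the outputs.
\<close>

section \<open>The Plancherel theorem\<close>

lemma integrable_fourier_kernel:
  assumes "integrable lborel f"
  shows "integrable lborel (\<lambda>t. f t * exp (- (\<i> * complex_of_real s * complex_of_real t)))"
proof (rule Bochner_Integration.integrable_bound[OF assms])
  show "(\<lambda>t. f t * exp (- (\<i> * complex_of_real s * complex_of_real t))) \<in> borel_measurable lborel"
    using assms by measurable
qed (simp add: norm_mult)

lemma borel_measurable_fourier [measurable]:
  assumes [measurable]: "f \<in> borel_measurable borel"
  shows "fourier f \<in> borel_measurable borel"
proof -
  have "(\<lambda>s. LINT t|lborel. f t * exp (- (\<i> * complex_of_real s * complex_of_real t)))
      \<in> borel_measurable borel"
    by measurable
  then show ?thesis
    by (simp add: fourier_def[abs_def])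
qed

lemma cmod_fourier_le: "cmod (fourier f s) \<le> (LINT t|lborel. cmod (f t))"
  unfolding fourier_def
  by (rule order_trans[OF integral_norm_bound]) (simp add: norm_mult)

lemma integrable_fourier_mult:
  assumes f: "integrable lborel f" and g: "integrable lborel g"
  shows "integrable lborel (\<lambda>s. fourier f s * g s)"
proof (rule Bochner_Integration.integrable_bound)
  show "integrable lborel (\<lambda>s. complex_of_real (LINT t|lborel. cmod (f t)) * g s)"
    using g by simp
  show "(\<lambda>s. fourier f s * g s) \<in> borel_measurable lborel"
    using f g by measurable
  show "AE s in lborel. norm (fourier f s * g s)
      \<le> norm (complex_of_real (LINT t|lborel. cmod (f t)) * g s)"
    by (auto simp: norm_mult intro!: mult_right_mono cmod_fourier_le)
qed

text \<open>Fubini: the joint integrand is dominated by \<open>|f t| |g s|\<close>, and the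
  exponential kernel is symmetric in \<open>s\<close> and \<open>t\<close>, so either variable may
  be integrated first.\<close>

lemma fourier_multiplication_formula:
  assumes f: "integrable lborel f" and g: "integrable lborel g"
  shows "(LINT s|lborel. fourier f s * g s) = (LINT t|lborel. f t * fourier g t)"
proof -
  let ?F = "\<lambda>s t. f t * g s * exp (- (\<i> * complex_of_real s * complex_of_real t))"
  have [measurable]: "f \<in> borel_measurable borel" "g \<in> borel_measurable borel"
    using f g by auto
  have "integrable (lborel \<Otimes>\<^sub>M lborel) (\<lambda>(s, t). ?F s t)"
  proof (rule lborel_pair.Fubini_integrable)
    show "(\<lambda>(s, t). ?F s t) \<in> borel_measurable (lborel \<Otimes>\<^sub>M lborel)"
      by measurable
    have "integrable lborel (\<lambda>s. (LINT t|lborel. cmod (f t)) * cmod (g s))"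
      using g by simp
    then show "integrable lborel (\<lambda>s. LINT t|lborel. norm (case (s, t) of (s, t) \<Rightarrow> ?F s t))"
      by (simp add: norm_mult)
    have "integrable lborel (\<lambda>t. g s * (f t * exp (- (\<i> * complex_of_real s * complex_of_real t))))" for s
      by (intro integrable_mult_right integrable_fourier_kernel f)
    then show "AE s in lborel. integrable lborel (\<lambda>t. case (s, t) of (s, t) \<Rightarrow> ?F s t)"
      by (simp add: mult_ac)
  qed
  from lborel_pair.Fubini_integral[OF this]
  have eq: "(LINT t|lborel. LINT s|lborel. ?F s t) = (LINT s|lborel. LINT t|lborel. ?F s t)" .
  have "(LINT t|lborel. ?F s t) = fourier f s * g s" for s
  proof -
    have "?F s t = f t * exp (- (\<i> * complex_of_real s * complex_of_real t)) * g s" for t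
      by simp
    then show ?thesis
      by (simp only: fourier_def) simp
  qed
  moreover have "(LINT s|lborel. ?F s t) = f t * fourier g t" for t
  proof -
    have "?F s t = f t * (g s * exp (- (\<i> * complex_of_real t * complex_of_real s)))" for s
      by (simp add: mult_ac)
    then show ?thesis
      by (simp only: fourier_def) simp
  qed
  ultimately show ?thesis
    using eq by simp
qed

section \<open>Gaussian regularisation of Parseval's identity\<close>

text \<open>A damping factor for the frequency side: it tends to 1 pointwise as
  \<open>\<sigma>\<close> tends to 0, and for \<open>\<sigma> > 0\<close> its Fourier transform is a
  multiple of the normal density of standard deviation \<open>\<sigma>\<close>.\<close>

definition gauss :: "real \<Rightarrow> real \<Rightarrow> real" where
  "gauss \<sigma> s = exp (- (\<sigma> * s)\<^sup>2 / 2)"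

lemma gauss_even [simp]: "gauss \<sigma> (- s) = gauss \<sigma> s"
  by (simp add: gauss_def)

lemma gauss_pos: "0 < gauss \<sigma> s" and gauss_le_1: "gauss \<sigma> s \<le> 1"
  by (simp_all add: gauss_def)

lemma borel_measurable_gauss [measurable]: "gauss \<sigma> \<in> borel_measurable borel"
  by (simp add: gauss_def[abs_def])

lemma gauss_normal_density:
  assumes "\<sigma> > 0"
  shows "gauss \<sigma> s = sqrt (2 * pi) / \<sigma> * normal_density 0 (1 / \<sigma>) s"
  using assms
  by (simp add: gauss_def normal_density_def real_sqrt_mult real_sqrt_divide field_simps)

lemma integrable_gauss:
  assumes "\<sigma> > 0"
  shows "integrable lborel (\<lambda>s. complex_of_real (gauss \<sigma> s))"
  using assms by (simp add: gauss_normal_density integrable_of_real del: of_real_mult)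

lemma integral_exp_std_normal:
  "(LINT x|lborel. complex_of_real (std_normal_density x) * exp (\<i> * complex_of_real (t * x)))
     = complex_of_real (exp (- t\<^sup>2 / 2))"
proof -
  have "char std_normal_distribution t
      = (LINT x|lborel. std_normal_density x *\<^sub>R exp (\<i> * complex_of_real (t * x)))"
    unfolding char_def by (subst integral_density) auto
  then show ?thesis
    by (simp add: char_std_normal_distribution scaleR_conv_of_real)
qed

text \<open>The substitution \<open>s = x / \<sigma>\<close> reduces this to the characteristic
  function of the standard normal distribution.\<close>

lemma fourier_gauss:
  assumes "\<sigma> > 0"
  shows "fourier (\<lambda>s. complex_of_real (gauss \<sigma> s)) t = complex_of_real (2 * pi * normal_density 0 \<sigma> t)"
proof -
  have "fourier (\<lambda>s. complex_of_real (gauss \<sigma> s)) t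
      = (1 / \<sigma>) *\<^sub>R (LINT x|lborel. complex_of_real (gauss \<sigma> (0 + (1 / \<sigma>) * x))
          * exp (- (\<i> * complex_of_real t * complex_of_real (0 + (1 / \<sigma>) * x))))"
    unfolding fourier_def using assms
    by (subst lborel_integral_real_affine[where c = "1 / \<sigma>" and t = 0]) auto
  also have "(LINT x|lborel. complex_of_real (gauss \<sigma> (0 + (1 / \<sigma>) * x))
          * exp (- (\<i> * complex_of_real t * complex_of_real (0 + (1 / \<sigma>) * x))))
     = (LINT x|lborel. complex_of_real (sqrt (2 * pi)) *
         (complex_of_real (std_normal_density x) * exp (\<i> * complex_of_real ((- t / \<sigma>) * x))))"
    using assms by (intro Bochner_Integration.integral_cong refl)
      (simp add: gauss_def std_normal_density_def algebra_simps)
  also have "\<dots> = complex_of_real (sqrt (2 * pi)) * complex_of_real (exp (- (- t / \<sigma>)\<^sup>2 / 2))"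
    by (subst integral_mult_right_zero) (simp only: integral_exp_std_normal)
  also have "(1 / \<sigma>) *\<^sub>R (complex_of_real (sqrt (2 * pi)) * complex_of_real (exp (- (- t / \<sigma>)\<^sup>2 / 2)))
     = complex_of_real (2 * pi * normal_density 0 \<sigma> t)"
  proof -
    have "1 / \<sigma> * (sqrt (2 * pi) * exp (- (- t / \<sigma>)\<^sup>2 / 2)) = 2 * pi * normal_density 0 \<sigma> t"
    proof -
      have "2 * pi = sqrt (2 * pi) * sqrt (2 * pi)" by simp
      then have "1 / \<sigma> * (sqrt (2 * pi) * e) = 2 * pi * (1 / (sqrt (2 * pi) * \<sigma>) * e)" for e
        using assms by (simp add: field_simps del: real_sqrt_mult_self)
      moreover have "normal_density 0 \<sigma> t = 1 / (sqrt (2 * pi) * \<sigma>) * exp (- (t / \<sigma>)\<^sup>2 / 2)"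
        using assms by (simp add: normal_density_def real_sqrt_mult power_divide mult_ac)
      ultimately show ?thesis
        by (simp add: power_divide)
    qed
    then show ?thesis
      by (metis of_real_mult scaleR_conv_of_real)
  qed
  finally show ?thesis .
qed

text \<open>Convolution of \<open>h\<close> with an even normal density, an approximate identity as
  \<open>\<sigma>\<close> tends to 0 from above.\<close>

definition smoothing :: "real \<Rightarrow> (real \<Rightarrow> complex) \<Rightarrow> real \<Rightarrow> complex" where
  "smoothing \<sigma> h t = (LINT x|lborel. h x * complex_of_real (normal_density 0 \<sigma> (x - t)))"

text \<open>Fourier inversion with Gaussian damping: the multiplication formula moves the transform
  from \<open>h\<close> onto the Gaussian times a character, whose transform is a normal density
  translated by \<open>t\<close>.\<close>

lemma fourier_fourier_gauss:
  assumes \<sigma>: "\<sigma> > 0" and h: "integrable lborel h"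
  shows "fourier (\<lambda>s. fourier h (- s) * complex_of_real (gauss \<sigma> s)) t = 2 * pi * smoothing \<sigma> h t"
proof -
  let ?g = "\<lambda>s. complex_of_real (gauss \<sigma> s) * exp (- (\<i> * complex_of_real (- t) * complex_of_real s))"
  have g: "integrable lborel ?g"
    by (intro integrable_fourier_kernel integrable_gauss \<sigma>)
  have "fourier (\<lambda>s. fourier h (- s) * complex_of_real (gauss \<sigma> s)) t = (LINT s|lborel. fourier h s * ?g s)"
    unfolding fourier_def[of "\<lambda>s. fourier h (- s) * complex_of_real (gauss \<sigma> s)"]
    by (subst lborel_integral_real_affine[where c = "-1" and t = 0]) (auto simp: mult_ac)
  also have "\<dots> = (LINT x|lborel. h x * fourier ?g x)"
    by (rule fourier_multiplication_formula[OF h g])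
  also have "fourier ?g = (\<lambda>x. fourier (\<lambda>s. complex_of_real (gauss \<sigma> s)) (x - t))"
    by (simp add: fourier_def fun_eq_iff mult.assoc exp_add[symmetric] algebra_simps)
  also have "(LINT x|lborel. h x * fourier (\<lambda>s. complex_of_real (gauss \<sigma> s)) (x - t))
      = (LINT x|lborel. 2 * pi * (h x * complex_of_real (normal_density 0 \<sigma> (x - t))))"
    by (simp add: fourier_gauss[OF \<sigma>] mult_ac)
  also have "\<dots> = 2 * pi * smoothing \<sigma> h t"
    unfolding smoothing_def by (rule integral_mult_right_zero)
  finally show ?thesis .
qed

text \<open>A second use of the multiplication formula, now with the damped reflected transform of
  \<open>h\<close>. The pairing is bilinear; the choice \<open>h = cnj f\<close> turns the left side
  into a damped integral of \<open>|fourier f|^2\<close>.\<close>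

lemma gaussian_parseval:
  assumes \<sigma>: "\<sigma> > 0" and f: "integrable lborel f" and h: "integrable lborel h"
  shows "(LINT s|lborel. fourier f s * (fourier h (- s) * complex_of_real (gauss \<sigma> s)))
    = 2 * pi * (LINT t|lborel. f t * smoothing \<sigma> h t)"
proof -
  have "integrable lborel (\<lambda>s. fourier h (- s) * complex_of_real (gauss \<sigma> s))"
    using lborel_integrable_real_affine[OF integrable_fourier_mult[OF h integrable_gauss[OF \<sigma>]],
        where c = "-1" and t = 0]
    by simp
  from fourier_multiplication_formula[OF f this]
  have "(LINT s|lborel. fourier f s * (fourier h (- s) * complex_of_real (gauss \<sigma> s)))
    = (LINT t|lborel. 2 * pi * (f t * smoothing \<sigma> h t))"
    by (simp add: fourier_fourier_gauss[OF \<sigma> h] mult_ac)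
  then show ?thesis
    by (simp only: integral_mult_right_zero)
qed

lemma fourier_cnj: "fourier (\<lambda>t. cnj (f t)) (- s) = cnj (fourier f s)"
proof -
  have "cnj (fourier f s) = (LINT t|lborel. cnj (f t * exp (- (\<i> * complex_of_real s * complex_of_real t))))"
    unfolding fourier_def by (rule Bochner_Integration.integral_cnj[symmetric])
  then show ?thesis
    by (simp add: fourier_def exp_cnj)
qed

lemma borel_measurable_cnj [measurable]: "cnj \<in> borel_measurable borel"
  by (intro borel_measurable_continuous_onI continuous_intros)

lemma integrable_cnj: "integrable M f \<Longrightarrow> integrable M (\<lambda>x. cnj (f x))"
  by simp

lemma nn_integral_normal_density:
  assumes "\<sigma> > 0"
  shows "(\<integral>\<^sup>+x. ennreal (normal_density 0 \<sigma> (x - t)) \<partial>lborel) = 1"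
    and "(\<integral>\<^sup>+t. ennreal (normal_density 0 \<sigma> (x - t)) \<partial>lborel) = 1"
proof -
  have *: "(\<integral>\<^sup>+x. ennreal (normal_density \<mu> \<sigma> x) \<partial>lborel) = 1" for \<mu>
    using assms by (subst nn_integral_eq_integral) auto
  have "normal_density 0 \<sigma> (x - t) = normal_density t \<sigma> x"
    "normal_density 0 \<sigma> (x - t) = normal_density x \<sigma> t" for x t
    by (simp_all add: normal_density_def power2_commute)
  then show "(\<integral>\<^sup>+x. ennreal (normal_density 0 \<sigma> (x - t)) \<partial>lborel) = 1"
    "(\<integral>\<^sup>+t. ennreal (normal_density 0 \<sigma> (x - t)) \<partial>lborel) = 1"
    by (metis (no_types, lifting) * nn_integral_cong)+
qed

text \<open>For integrable \<open>f\<close> this is the triangle inequality; otherwise the Bochner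
  integral is 0 by convention.\<close>

lemma cmod_integral_le_nn_integral:
  "ennreal (cmod (integral\<^sup>L M f)) \<le> (\<integral>\<^sup>+x. ennreal (cmod (f x)) \<partial>M)"
  by (cases "integrable M f") (auto simp: integral_norm_bound_ennreal not_integrable_integral_eq)

text \<open>Young's inequality \<open>a b \<le> a^2/2 + b^2/2\<close> under the kernel, followed by
  Tonelli: the normal density has mass 1 in either variable. The bound does not depend on
  \<open>\<sigma>\<close>.\<close>

lemma nn_integral_mult_smoothing_le:
  assumes \<sigma>: "\<sigma> > 0" and [measurable]: "f \<in> borel_measurable borel" "h \<in> borel_measurable borel"
  shows "(\<integral>\<^sup>+t. ennreal (cmod (f t * smoothing \<sigma> h t)) \<partial>lborel)
    \<le> ennreal (1/2) * (\<integral>\<^sup>+t. ennreal ((cmod (f t))\<^sup>2) \<partial>lborel)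
      + ennreal (1/2) * (\<integral>\<^sup>+x. ennreal ((cmod (h x))\<^sup>2) \<partial>lborel)"
proof -
  let ?N = "\<lambda>t x. ennreal (normal_density 0 \<sigma> (x - t))"
  have "ennreal (cmod (f t * smoothing \<sigma> h t))
      \<le> (\<integral>\<^sup>+x. ennreal (1/2) * (ennreal ((cmod (f t))\<^sup>2) * ?N t x)
        + ennreal (1/2) * (ennreal ((cmod (h x))\<^sup>2) * ?N t x) \<partial>lborel)" for t
  proof -
    have "ennreal (cmod (f t * smoothing \<sigma> h t))
        \<le> ennreal (cmod (f t)) * (\<integral>\<^sup>+x. ennreal (cmod (h x * complex_of_real (normal_density 0 \<sigma> (x - t)))) \<partial>lborel)"
      unfolding norm_mult[of "f t"] smoothing_def
      by (subst ennreal_mult) (auto intro!: mult_left_mono cmod_integral_le_nn_integral)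
    also have "\<dots> = (\<integral>\<^sup>+x. ennreal (cmod (f t)) * ennreal (cmod (h x * complex_of_real (normal_density 0 \<sigma> (x - t)))) \<partial>lborel)"
      by (intro nn_integral_cmult[symmetric]) measurable
    also have "\<dots> \<le> (\<integral>\<^sup>+x. ennreal (1/2) * (ennreal ((cmod (f t))\<^sup>2) * ?N t x)
        + ennreal (1/2) * (ennreal ((cmod (h x))\<^sup>2) * ?N t x) \<partial>lborel)"
    proof (intro nn_integral_mono)
      fix x
      let ?n = "normal_density 0 \<sigma> (x - t)"
      have "cmod (f t) * cmod (h x) \<le> 1/2 * (cmod (f t))\<^sup>2 + 1/2 * (cmod (h x))\<^sup>2"
        using sum_squares_bound[of "cmod (f t)" "cmod (h x)"] by simp
      then have "cmod (f t) * cmod (h x) * ?n \<le> (1/2 * (cmod (f t))\<^sup>2 + 1/2 * (cmod (h x))\<^sup>2) * ?n"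
        by (rule mult_right_mono) simp
      then have "ennreal (cmod (f t) * (cmod (h x) * ?n))
          \<le> ennreal (1/2 * ((cmod (f t))\<^sup>2 * ?n) + 1/2 * ((cmod (h x))\<^sup>2 * ?n))"
        by (intro ennreal_leI) (simp add: algebra_simps)
      then show "ennreal (cmod (f t)) * ennreal (cmod (h x * complex_of_real ?n))
          \<le> ennreal (1/2) * (ennreal ((cmod (f t))\<^sup>2) * ?N t x)
            + ennreal (1/2) * (ennreal ((cmod (h x))\<^sup>2) * ?N t x)"
        by (simp only: ennreal_mult[symmetric] ennreal_plus[symmetric] norm_mult norm_of_real
            abs_of_nonneg[OF normal_density_nonneg] zero_le_power2 norm_ge_zero normal_density_nonneg
            mult_nonneg_nonneg zero_le_divide_1_iff zero_le_numeral)
    qed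
    finally show ?thesis .
  qed
  then have "(\<integral>\<^sup>+t. ennreal (cmod (f t * smoothing \<sigma> h t)) \<partial>lborel)
    \<le> (\<integral>\<^sup>+t. \<integral>\<^sup>+x. ennreal (1/2) * (ennreal ((cmod (f t))\<^sup>2) * ?N t x)
        + ennreal (1/2) * (ennreal ((cmod (h x))\<^sup>2) * ?N t x) \<partial>lborel \<partial>lborel)"
    by (rule nn_integral_mono)
  also have "\<dots> = (\<integral>\<^sup>+t. (ennreal (1/2) * ennreal ((cmod (f t))\<^sup>2)
       + ennreal (1/2) * (\<integral>\<^sup>+x. ennreal ((cmod (h x))\<^sup>2) * ?N t x \<partial>lborel)) \<partial>lborel)"
    by (subst nn_integral_add) (auto simp: nn_integral_cmult nn_integral_normal_density[OF \<sigma>])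
  also have "\<dots> = ennreal (1/2) * (\<integral>\<^sup>+t. ennreal ((cmod (f t))\<^sup>2) \<partial>lborel)
      + ennreal (1/2) * (\<integral>\<^sup>+t. \<integral>\<^sup>+x. ennreal ((cmod (h x))\<^sup>2) * ?N t x \<partial>lborel \<partial>lborel)"
    by (subst nn_integral_add) (auto simp: nn_integral_cmult)
  also have "(\<integral>\<^sup>+t. \<integral>\<^sup>+x. ennreal ((cmod (h x))\<^sup>2) * ?N t x \<partial>lborel \<partial>lborel)
      = (\<integral>\<^sup>+x. \<integral>\<^sup>+t. ennreal ((cmod (h x))\<^sup>2) * ?N t x \<partial>lborel \<partial>lborel)"
    by (rule lborel_pair.Fubini') simp
  also have "\<dots> = (\<integral>\<^sup>+x. ennreal ((cmod (h x))\<^sup>2) \<partial>lborel)"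
    by (simp add: nn_integral_cmult nn_integral_normal_density[OF \<sigma>])
  finally show ?thesis .
qed

section \<open>The upper bound in Plancherel's identity\<close>

lemma gauss_tendsto_1: "(\<lambda>k. gauss (1 / real (Suc k)) s) \<longlonglongrightarrow> 1"
proof -
  have "(\<lambda>k. exp (- (1 / real (Suc k) * s)\<^sup>2 / 2)) \<longlonglongrightarrow> exp (- (0 * s)\<^sup>2 / 2)"
    by (intro tendsto_intros LIMSEQ_Suc[OF lim_1_over_n]) simp_all
  then show ?thesis
    by (simp add: gauss_def)
qed

text \<open>With \<open>h = cnj f\<close> the Gaussian Parseval identity computes the damped
  integral of \<open>|fourier f|^2\<close>. It is bounded uniformly in \<open>\<sigma>\<close>, and
  Fatou's lemma removes the damping.\<close>

lemma nn_integral_fourier_le: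
  assumes f: "integrable lborel f"
  shows "(\<integral>\<^sup>+s. ennreal ((cmod (fourier f s))\<^sup>2) \<partial>lborel)
    \<le> ennreal (2 * pi) * (\<integral>\<^sup>+t. ennreal ((cmod (f t))\<^sup>2) \<partial>lborel)"
proof -
  let ?I = "\<integral>\<^sup>+t. ennreal ((cmod (f t))\<^sup>2) \<partial>lborel"
  have [measurable]: "f \<in> borel_measurable borel"
    using f by auto
  have le: "(\<integral>\<^sup>+s. ennreal ((cmod (fourier f s))\<^sup>2 * gauss \<sigma> s) \<partial>lborel) \<le> ennreal (2 * pi) * ?I"
    if \<sigma>: "\<sigma> > 0" for \<sigma>
  proof -
    have eq: "fourier f s * (fourier (\<lambda>t. cnj (f t)) (- s) * complex_of_real (gauss \<sigma> s))
        = complex_of_real ((cmod (fourier f s))\<^sup>2 * gauss \<sigma> s)" for s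
      by (simp only: fourier_cnj mult.assoc[symmetric] complex_norm_square[symmetric] of_real_mult of_real_power)
    have "integrable lborel (\<lambda>s. fourier f s * (fourier (\<lambda>t. cnj (f t)) (- s) * complex_of_real (gauss \<sigma> s)))"
      using integrable_fourier_mult[OF f integrable_cnj[OF integrable_fourier_mult[OF f integrable_gauss[OF \<sigma>]]]]
      by (simp add: fourier_cnj)
    then have int: "integrable lborel (\<lambda>s. (cmod (fourier f s))\<^sup>2 * gauss \<sigma> s)"
      unfolding eq complex_of_real_integrable_eq .
    have "complex_of_real (LINT s|lborel. (cmod (fourier f s))\<^sup>2 * gauss \<sigma> s)
        = 2 * pi * (LINT t|lborel. f t * smoothing \<sigma> (\<lambda>t. cnj (f t)) t)"
      using gaussian_parseval[OF \<sigma> f integrable_cnj[OF f]] unfolding eq integral_complex_of_real by simp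
    then have "cmod (complex_of_real (LINT s|lborel. (cmod (fourier f s))\<^sup>2 * gauss \<sigma> s))
        = 2 * pi * cmod (LINT t|lborel. f t * smoothing \<sigma> (\<lambda>t. cnj (f t)) t)"
      by (simp add: norm_mult del: of_real_mult)
    moreover have "0 \<le> (LINT s|lborel. (cmod (fourier f s))\<^sup>2 * gauss \<sigma> s)"
      by (intro Bochner_Integration.integral_nonneg) (simp add: gauss_pos less_imp_le)
    ultimately have "(\<integral>\<^sup>+s. ennreal ((cmod (fourier f s))\<^sup>2 * gauss \<sigma> s) \<partial>lborel)
        = ennreal (2 * pi) * ennreal (cmod (LINT t|lborel. f t * smoothing \<sigma> (\<lambda>t. cnj (f t)) t))"
      by (subst nn_integral_eq_integral[OF int])
        (auto simp: gauss_pos less_imp_le ennreal_mult[symmetric])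
    also have "\<dots> \<le> ennreal (2 * pi) * (\<integral>\<^sup>+t. ennreal (cmod (f t * smoothing \<sigma> (\<lambda>t. cnj (f t)) t)) \<partial>lborel)"
      by (intro mult_left_mono cmod_integral_le_nn_integral) auto
    also have "\<dots> \<le> ennreal (2 * pi) * (ennreal (1/2) * ?I + ennreal (1/2) * ?I)"
      using nn_integral_mult_smoothing_le[OF \<sigma>, of f "\<lambda>t. cnj (f t)"]
      by (intro mult_left_mono) auto
    also have "ennreal (1/2) * ?I + ennreal (1/2) * ?I = ?I"
    proof -
      have "ennreal (1/2) + ennreal (1/2) = 1"
        by (subst ennreal_plus[symmetric]) auto
      then show ?thesis
        by (simp only: distrib_right[symmetric] mult_1)
    qed
    finally show ?thesis .
  qed
  \<comment> \<open>The damping with \<open>\<sigma> = 1 / (k + 1)\<close> converges pointwise to 1,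
    so the integrand is a limit inferior, as Fatou's lemma requires.\<close>
  have "(\<integral>\<^sup>+s. ennreal ((cmod (fourier f s))\<^sup>2) \<partial>lborel)
      = (\<integral>\<^sup>+s. liminf (\<lambda>k. ennreal ((cmod (fourier f s))\<^sup>2 * gauss (1 / real (Suc k)) s)) \<partial>lborel)"
  proof (intro nn_integral_cong lim_imp_Liminf[symmetric])
    fix s
    have "(\<lambda>k. (cmod (fourier f s))\<^sup>2 * gauss (1 / real (Suc k)) s) \<longlonglongrightarrow> (cmod (fourier f s))\<^sup>2 * 1"
      by (intro tendsto_intros gauss_tendsto_1)
    then show "(\<lambda>k. ennreal ((cmod (fourier f s))\<^sup>2 * gauss (1 / real (Suc k)) s))
        \<longlonglongrightarrow> ennreal ((cmod (fourier f s))\<^sup>2)"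
      by (intro tendsto_ennrealI) simp
  qed simp
  also have "\<dots> \<le> liminf (\<lambda>k. \<integral>\<^sup>+s. ennreal ((cmod (fourier f s))\<^sup>2 * gauss (1 / real (Suc k)) s) \<partial>lborel)"
    by (rule nn_integral_liminf) measurable
  also have "\<dots> \<le> ennreal (2 * pi) * ?I"
    by (intro Liminf_le always_eventually allI le) auto
  finally show ?thesis .
qed

text \<open>Rescaling moves the dependence on \<open>k\<close> from the density into the argument of
  \<open>h\<close>. Dominated convergence then applies, by continuity at \<open>t\<close> and the
  bound \<open>B\<close>.\<close>

lemma smoothing_tendsto:
  assumes cont: "continuous_on UNIV h" and B: "\<And>t. cmod (h t) \<le> B"
  shows "(\<lambda>k. smoothing (1 / real (Suc k)) h t) \<longlonglongrightarrow> h t"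
proof -
  have [measurable]: "h \<in> borel_measurable borel"
    by (rule borel_measurable_continuous_onI[OF cont])
  have eq: "smoothing (1 / real (Suc k)) h t
      = (LINT x|lborel. h (t + (1 / real (Suc k)) * x) * complex_of_real (std_normal_density x))" for k
  proof -
    have "normal_density 0 (1 / real (Suc k)) ((1 / real (Suc k)) * x) = real (Suc k) * std_normal_density x" for x
      by (simp add: normal_density_def real_sqrt_divide power_divide)
    then show ?thesis
      unfolding smoothing_def
      by (subst lborel_integral_real_affine[where c = "1 / real (Suc k)" and t = t])
        (simp_all add: mult.left_commute[of "h _"] scaleR_conv_of_real del: of_nat_Suc)
  qed
  have "(\<lambda>k. LINT x|lborel. h (t + (1 / real (Suc k)) * x) * complex_of_real (std_normal_density x))
      \<longlonglongrightarrow> (LINT x|lborel. h t * complex_of_real (std_normal_density x))"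
  proof (rule integral_dominated_convergence[where w = "\<lambda>x. B * std_normal_density x"])
    have "(\<lambda>k. h (t + (1 / real (Suc k)) * x)) \<longlonglongrightarrow> h (t + 0 * x)" for x
      by (rule continuous_on_tendsto_compose[OF cont])
        (intro tendsto_intros LIMSEQ_Suc[OF lim_1_over_n], simp_all)
    then show "AE x in lborel. (\<lambda>k. h (t + (1 / real (Suc k)) * x) * complex_of_real (std_normal_density x))
        \<longlonglongrightarrow> h t * complex_of_real (std_normal_density x)"
      by (intro AE_I2 tendsto_intros) simp
    show "AE x in lborel. norm (h (t + (1 / real (Suc k)) * x) * complex_of_real (std_normal_density x))
        \<le> B * std_normal_density x" for k
      by (auto simp: norm_mult B intro!: mult_right_mono)
  qed auto
  also have "(LINT x|lborel. h t * complex_of_real (std_normal_density x)) = h t"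
    by simp
  finally show ?thesis
    unfolding eq .
qed

lemma smoothing_bounded:
  assumes \<sigma>: "\<sigma> > 0" and [measurable]: "h \<in> borel_measurable borel" and B: "\<And>t. cmod (h t) \<le> B"
  shows "cmod (smoothing \<sigma> h t) \<le> B"
proof -
  have B0: "0 \<le> B"
    using B[of 0] norm_ge_zero order_trans by blast
  have "ennreal (cmod (smoothing \<sigma> h t))
      \<le> (\<integral>\<^sup>+x. ennreal (cmod (h x * complex_of_real (normal_density 0 \<sigma> (x - t)))) \<partial>lborel)"
    unfolding smoothing_def by (rule cmod_integral_le_nn_integral)
  also have "\<dots> \<le> (\<integral>\<^sup>+x. ennreal B * ennreal (normal_density 0 \<sigma> (x - t)) \<partial>lborel)"
    by (intro nn_integral_mono)
      (auto simp: norm_mult ennreal_mult[symmetric] B0 intro!: ennreal_leI mult_right_mono B)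
  also have "\<dots> = ennreal B"
    by (simp add: nn_integral_cmult nn_integral_normal_density[OF \<sigma>])
  finally show ?thesis
    using B0 by simp
qed

lemma fourier_square_integrable:
  assumes f: "integrable lborel f" and f2: "integrable lborel (\<lambda>t. (cmod (f t))\<^sup>2)"
  shows "integrable lborel (\<lambda>s. (cmod (fourier f s))\<^sup>2)"
    and "(LINT s|lborel. (cmod (fourier f s))\<^sup>2) \<le> 2 * pi * (LINT t|lborel. (cmod (f t))\<^sup>2)"
proof -
  have [measurable]: "f \<in> borel_measurable borel"
    using f by auto
  have le: "(\<integral>\<^sup>+s. ennreal ((cmod (fourier f s))\<^sup>2) \<partial>lborel)
      \<le> ennreal (2 * pi * (LINT t|lborel. (cmod (f t))\<^sup>2))"
    using nn_integral_fourier_le[OF f]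
    by (simp add: nn_integral_eq_integral[OF f2] ennreal_mult[symmetric] del: ennreal_mult'')
  show int: "integrable lborel (\<lambda>s. (cmod (fourier f s))\<^sup>2)"
    by (intro integrableI_bounded) (auto intro: le_less_trans[OF le])
  show "(LINT s|lborel. (cmod (fourier f s))\<^sup>2) \<le> 2 * pi * (LINT t|lborel. (cmod (f t))\<^sup>2)"
    using le by (simp add: nn_integral_eq_integral[OF int])
qed

section \<open>The lower bound in Plancherel's identity, by duality\<close>

text \<open>The pairing with a test function is moved to the frequency side. Young's inequality and
  the upper bound for the transform of \<open>h\<close> give the two terms after division by
  \<open>2 * pi\<close>; continuity and boundedness of \<open>h\<close> justify the passage from
  \<open>smoothing \<sigma> h\<close> to \<open>h\<close>.\<close>

lemma cmod_integral_mult_le_fourier: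
  assumes f: "integrable lborel f" and F: "integrable lborel (\<lambda>s. (cmod (fourier f s))\<^sup>2)"
    and cont: "continuous_on UNIV h" and B: "\<And>t. cmod (h t) \<le> B"
    and h: "integrable lborel h" and h2: "integrable lborel (\<lambda>t. (cmod (h t))\<^sup>2)"
  shows "cmod (LINT t|lborel. f t * h t)
    \<le> (LINT s|lborel. (cmod (fourier f s))\<^sup>2) / (4 * pi) + (LINT t|lborel. (cmod (h t))\<^sup>2) / 2"
    (is "_ \<le> ?A / _ + ?H / 2")
proof -
  have [measurable]: "f \<in> borel_measurable borel" "h \<in> borel_measurable borel"
    using f h by auto
  have le: "cmod (LINT t|lborel. f t * smoothing \<sigma> h t) \<le> ?A / (4 * pi) + ?H / 2" if \<sigma>: "\<sigma> > 0" for \<sigma>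
  proof -
    let ?g = "\<lambda>s. fourier h (- s)"
    have g_int: "integrable lborel (\<lambda>s. ?g s * complex_of_real (gauss \<sigma> s))"
      using lborel_integrable_real_affine[OF integrable_fourier_mult[OF h integrable_gauss[OF \<sigma>]],
          where c = "-1" and t = 0]
      by simp
    have G: "integrable lborel (\<lambda>s. (cmod (?g s))\<^sup>2)"
      using lborel_integrable_real_affine[OF fourier_square_integrable(1)[OF h h2], where c = "-1" and t = 0]
      by simp
    have "(LINT s|lborel. (cmod (?g s))\<^sup>2) = (LINT s|lborel. (cmod (fourier h s))\<^sup>2)"
      by (subst lborel_integral_real_affine[where c = "-1" and t = 0]) auto
    with fourier_square_integrable(2)[OF h h2]
    have G_le: "(LINT s|lborel. (cmod (?g s))\<^sup>2) \<le> 2 * pi * ?H"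
      by simp
    have "2 * pi * cmod (LINT t|lborel. f t * smoothing \<sigma> h t)
        = cmod (complex_of_real (2 * pi) * (LINT t|lborel. f t * smoothing \<sigma> h t))"
      by (simp add: norm_mult)
    also have "\<dots> = cmod (LINT s|lborel. fourier f s * (?g s * complex_of_real (gauss \<sigma> s)))"
      by (simp only: gaussian_parseval[OF \<sigma> f h] of_real_mult of_real_numeral)
    also have "\<dots> \<le> (LINT s|lborel. (cmod (fourier f s))\<^sup>2 / 2 + (cmod (?g s))\<^sup>2 / 2)"
    proof (intro Bochner_Integration.integral_norm_bound_integral)
      show "integrable lborel (\<lambda>s. fourier f s * (?g s * complex_of_real (gauss \<sigma> s)))"
        by (rule integrable_fourier_mult[OF f g_int])
      show "integrable lborel (\<lambda>s. (cmod (fourier f s))\<^sup>2 / 2 + (cmod (?g s))\<^sup>2 / 2)"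
        using F G by simp
      fix s
      have "norm (fourier f s * (?g s * complex_of_real (gauss \<sigma> s)))
          = cmod (fourier f s) * cmod (?g s) * gauss \<sigma> s"
        by (simp add: norm_mult gauss_pos less_imp_le)
      also have "\<dots> \<le> cmod (fourier f s) * cmod (?g s)"
        by (intro mult_right_le_one_le) (auto simp: gauss_pos less_imp_le gauss_le_1)
      also have "\<dots> \<le> (cmod (fourier f s))\<^sup>2 / 2 + (cmod (?g s))\<^sup>2 / 2"
        using sum_squares_bound[of "cmod (fourier f s)" "cmod (?g s)"] by simp
      finally show "norm (fourier f s * (?g s * complex_of_real (gauss \<sigma> s)))
          \<le> (cmod (fourier f s))\<^sup>2 / 2 + (cmod (?g s))\<^sup>2 / 2" .
    qed
    also have "\<dots> = ?A / 2 + (LINT s|lborel. (cmod (?g s))\<^sup>2) / 2"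
      using F G by simp
    also have "\<dots> \<le> ?A / 2 + pi * ?H"
      using G_le by simp
    finally show ?thesis
      by (simp add: field_simps)
  qed
  have "(\<lambda>k. LINT t|lborel. f t * smoothing (1 / real (Suc k)) h t) \<longlonglongrightarrow> (LINT t|lborel. f t * h t)"
  proof (rule integral_dominated_convergence[where w = "\<lambda>t. B * cmod (f t)"])
    show "AE t in lborel. (\<lambda>k. f t * smoothing (1 / real (Suc k)) h t) \<longlonglongrightarrow> f t * h t"
      by (intro AE_I2 tendsto_intros smoothing_tendsto[OF cont B])
    show "AE t in lborel. norm (f t * smoothing (1 / real (Suc k)) h t) \<le> B * cmod (f t)" for k
      using smoothing_bounded[OF _ _ B, of "1 / real (Suc k)"]
      by (auto simp: norm_mult mult.commute[of B] intro!: mult_left_mono)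
    show "(\<lambda>t. f t * smoothing (1 / real (Suc k)) h t) \<in> borel_measurable lborel" for k
      unfolding smoothing_def[abs_def] by measurable
    show "(\<lambda>t. f t * h t) \<in> borel_measurable lborel"
      by measurable
    show "integrable lborel (\<lambda>t. B * cmod (f t))"
      using f by simp
  qed
  then have "(\<lambda>k. cmod (LINT t|lborel. f t * smoothing (1 / real (Suc k)) h t))
      \<longlonglongrightarrow> cmod (LINT t|lborel. f t * h t)"
    by (rule tendsto_norm)
  then show ?thesis
    by (rule LIMSEQ_le_const2) (auto intro!: le)
qed

text \<open>For \<open>N > 0\<close> the radial projection onto the disc of radius \<open>N\<close>,
  in a form that is visibly continuous.\<close>

definition truncate :: "real \<Rightarrow> complex \<Rightarrow> complex" where
  "truncate N z = z / complex_of_real (max 1 (cmod z / N))"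

lemma cmod_truncate: "cmod (truncate N z) = cmod z / max 1 (cmod z / N)"
  by (simp add: truncate_def norm_divide)

lemma cmod_truncate_le: "N > 0 \<Longrightarrow> cmod (truncate N z) \<le> N"
  by (auto simp: cmod_truncate field_simps max_def)

lemma continuous_on_truncate: "N > 0 \<Longrightarrow> continuous_on UNIV (truncate N)"
  unfolding truncate_def[abs_def] by (intro continuous_intros) auto

lemma truncate_eq: "N > 0 \<Longrightarrow> cmod z \<le> N \<Longrightarrow> truncate N z = z"
  by (simp add: truncate_def max_def)

text \<open>Truncation divides by a positive real and so keeps the argument. The product is
  therefore a nonnegative real, and an integral of such products equals its own modulus.\<close>

lemma mult_cnj_truncate:
  "z * cnj (truncate N z) = complex_of_real (max 1 (cmod z / N) * (cmod (truncate N z))\<^sup>2)"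
proof -
  define m where "m = max 1 (cmod z / N)"
  have "m > 0" by (simp add: m_def)
  have "z * cnj (truncate N z) = z * cnj z / complex_of_real m"
    by (simp add: truncate_def m_def)
  also have "\<dots> = complex_of_real ((cmod z)\<^sup>2 / m)"
    by (simp only: complex_norm_square[symmetric] of_real_divide of_real_power)
  also have "(cmod z)\<^sup>2 / m = m * (cmod (truncate N z))\<^sup>2"
    using \<open>m > 0\<close> by (simp add: cmod_truncate m_def[symmetric] power_divide power2_eq_square)
  finally show ?thesis by (simp add: m_def)
qed

text \<open>For \<open>N \<ge> 0\<close> a trapezoid equal to 1 on \<open>[-N, N]\<close> and to 0
  outside \<open>[-N - 1, N + 1]\<close>; unlike an indicator it keeps test functions
  continuous.\<close>

definition cutoff :: "real \<Rightarrow> real \<Rightarrow> real" where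
  "cutoff N t = max 0 (min 1 (N + 1 - \<bar>t\<bar>))"

lemma cutoff_bounds [simp]: "0 \<le> cutoff N t" "cutoff N t \<le> 1"
  by (auto simp: cutoff_def)

lemma continuous_on_cutoff: "continuous_on A (cutoff N)"
  unfolding cutoff_def[abs_def] by (intro continuous_intros)

lemma borel_measurable_cutoff [measurable]: "cutoff N \<in> borel_measurable borel"
  by (intro borel_measurable_continuous_onI continuous_on_cutoff)

lemma integrable_cutoff [simp]: "integrable lborel (cutoff N)"
proof (rule Bochner_Integration.integrable_bound)
  show "integrable lborel (\<lambda>t. indicat_real {- (N + 1)..N + 1} t)"
    by (simp add: emeasure_lborel_Icc_eq)
qed (auto simp: cutoff_def indicator_def)

text \<open>A Borel function is Lebesgue measurable, hence an almost everywhere limit of continuous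
  functions. The size of these is not controlled; truncation and cutoff supply the domination
  later.\<close>

lemma tendsto_continuous_AE:
  fixes f :: "real \<Rightarrow> complex"
  assumes "f \<in> borel_measurable borel"
  obtains g where "\<And>k::nat. continuous_on UNIV (g k)" "AE t in lborel. (\<lambda>k. g k t) \<longlonglongrightarrow> f t"
proof -
  have "f \<in> borel_measurable lebesgue"
    using assms by (simp add: measurable_completion)
  then have "f measurable_on UNIV"
    by (intro lebesgue_measurable_imp_measurable_on) auto
  then obtain N g where N: "negligible N" and g: "\<And>k. continuous_on UNIV (g k)"
    and lim: "\<And>t. t \<notin> N \<Longrightarrow> (\<lambda>k. g k t) \<longlonglongrightarrow> f t"
    unfolding measurable_on_def by auto
  have "AE t in lebesgue. (\<lambda>k. g k t) \<longlonglongrightarrow> f t"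
    using N lim by (intro AE_I'[of N]) (auto simp: negligible_iff_null_sets)
  then have "AE t in lborel. (\<lambda>k. g k t) \<longlonglongrightarrow> f t"
    by (simp add: AE_completion_iff)
  with g show ?thesis by (rule that)
qed

text \<open>The ideal test function is \<open>cnj f\<close>, which need be neither bounded nor
  continuous. It is truncated and cut off to \<open>j\<close>, approximated by the continuous
  \<open>h k\<close>, tested by duality, and recovered by Fatou's lemma as \<open>N\<close>
  grows.\<close>

lemma integral_cmod_square_le_fourier:
  assumes f: "integrable lborel f" and F: "integrable lborel (\<lambda>s. (cmod (fourier f s))\<^sup>2)"
  shows "(\<integral>\<^sup>+t. ennreal ((cmod (f t))\<^sup>2) \<partial>lborel)
    \<le> ennreal ((LINT s|lborel. (cmod (fourier f s))\<^sup>2) / (2 * pi))"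
proof -
  define A where "A = (LINT s|lborel. (cmod (fourier f s))\<^sup>2)"
  have [measurable]: "f \<in> borel_measurable borel"
    using f by auto
  from tendsto_continuous_AE[OF this] obtain g where g: "\<And>k::nat. continuous_on UNIV (g k)"
    and lim: "AE t in lborel. (\<lambda>k. g k t) \<longlonglongrightarrow> f t" by blast
  have [measurable]: "g k \<in> borel_measurable borel" for k
    by (rule borel_measurable_continuous_onI[OF g])
  have main: "(\<integral>\<^sup>+t. ennreal ((cmod (truncate N (f t)) * cutoff N t)\<^sup>2) \<partial>lborel) \<le> ennreal (A / (2 * pi))"
    if N: "N > 0" for N
  proof -
    have [measurable]: "truncate N \<in> borel_measurable borel"
      by (rule borel_measurable_continuous_onI[OF continuous_on_truncate[OF N]])
    define h where "h k t = cnj (truncate N (g k t)) * complex_of_real (cutoff N t)" for k t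
    define j where "j t = cnj (truncate N (f t)) * complex_of_real (cutoff N t)" for t
    have [measurable]: "h k \<in> borel_measurable borel" "j \<in> borel_measurable borel" for k
      unfolding h_def[abs_def] j_def[abs_def] by measurable
    have cmod_h: "cmod (h k t) \<le> N * cutoff N t" and cmod_j: "cmod (j t) \<le> N * cutoff N t" for k t
      by (auto simp: h_def j_def norm_mult intro!: mult_right_mono cmod_truncate_le N)
    have cut: "N * cutoff N t \<le> N" for t
      using N by (simp add: mult_left_le)
    have square: "x\<^sup>2 \<le> N\<^sup>2 * cutoff N t" if "0 \<le> x" "x \<le> N * cutoff N t" for x t
    proof -
      have "x * x \<le> N * (N * cutoff N t)"
        using that cut[of t] by (intro mult_mono) auto
      then show ?thesis by (simp add: power2_eq_square)
    qed
    have hc: "continuous_on UNIV (h k)" for k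
      unfolding h_def[abs_def]
      by (intro continuous_intros continuous_on_cutoff
          continuous_on_compose2[OF continuous_on_truncate[OF N] g]) auto
    have hi: "integrable lborel (h k)" for k
      by (rule Bochner_Integration.integrable_bound[where f = "\<lambda>t. N * cutoff N t"])
        (use cmod_h N in auto)
    have hi2: "integrable lborel (\<lambda>t. (cmod (h k t))\<^sup>2)" for k
      by (rule Bochner_Integration.integrable_bound[where f = "\<lambda>t. N\<^sup>2 * cutoff N t"])
        (use square[OF norm_ge_zero cmod_h] in auto)
    have hlim: "AE t in lborel. (\<lambda>k. h k t) \<longlonglongrightarrow> j t"
      using lim
    proof eventually_elim
      case (elim t)
      then have "(\<lambda>k. truncate N (g k t)) \<longlonglongrightarrow> truncate N (f t)"
        by (intro continuous_on_tendsto_compose[OF continuous_on_truncate[OF N]]) auto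
      then show ?case
        unfolding h_def j_def by (intro tendsto_intros)
    qed
    have "cmod (LINT t|lborel. f t * h k t) \<le> A / (4 * pi) + (LINT t|lborel. (cmod (h k t))\<^sup>2) / 2" for k
      unfolding A_def
      by (rule cmod_integral_mult_le_fourier[OF f F hc _ hi hi2, where B = N])
        (rule order_trans[OF cmod_h cut])
    moreover have "(\<lambda>k. LINT t|lborel. f t * h k t) \<longlonglongrightarrow> (LINT t|lborel. f t * j t)"
    proof (rule integral_dominated_convergence[where w = "\<lambda>t. N * cmod (f t)"])
      show "AE t in lborel. (\<lambda>k. f t * h k t) \<longlonglongrightarrow> f t * j t"
        using hlim by eventually_elim (intro tendsto_intros)
      show "AE t in lborel. norm (f t * h k t) \<le> N * cmod (f t)" for k
        using order_trans[OF cmod_h cut]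
        by (auto simp: norm_mult mult.commute[of N] intro!: mult_left_mono)
    qed (use f in auto)
    moreover have "(\<lambda>k. LINT t|lborel. (cmod (h k t))\<^sup>2) \<longlonglongrightarrow> (LINT t|lborel. (cmod (j t))\<^sup>2)"
    proof (rule integral_dominated_convergence[where w = "\<lambda>t. N\<^sup>2 * cutoff N t"])
      show "AE t in lborel. (\<lambda>k. (cmod (h k t))\<^sup>2) \<longlonglongrightarrow> (cmod (j t))\<^sup>2"
        using hlim by eventually_elim (intro tendsto_intros)
      show "AE t in lborel. norm ((cmod (h k t))\<^sup>2) \<le> N\<^sup>2 * cutoff N t" for k
        using square[OF norm_ge_zero cmod_h] by auto
    qed auto
    ultimately have le: "cmod (LINT t|lborel. f t * j t) \<le> A / (4 * pi) + (LINT t|lborel. (cmod (j t))\<^sup>2) / 2"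
      by (intro LIMSEQ_le[OF tendsto_norm tendsto_add[OF tendsto_const tendsto_divide[OF _ tendsto_const]]])
        auto
    have ji2: "integrable lborel (\<lambda>t. (cmod (j t))\<^sup>2)"
      by (rule Bochner_Integration.integrable_bound[where f = "\<lambda>t. N\<^sup>2 * cutoff N t"])
        (use square[OF norm_ge_zero cmod_j] in auto)
    \<comment> \<open>The nonnegative real value of \<open>f * j\<close>. It dominates
      \<open>|j|^2\<close> because the \<open>max\<close> is at least 1 and the cutoff at most
      1.\<close>
    define r where "r t = max 1 (cmod (f t) / N) * (cmod (truncate N (f t)))\<^sup>2 * cutoff N t" for t
    have fj: "f t * j t = complex_of_real (r t)" for t
      unfolding j_def r_def mult.assoc[symmetric] mult_cnj_truncate by simp
    have jr: "(cmod (j t))\<^sup>2 \<le> r t" for t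
    proof -
      have "(cmod (j t))\<^sup>2 = 1 * (cmod (truncate N (f t)))\<^sup>2 * (cutoff N t * cutoff N t)"
        by (simp add: j_def norm_mult power_mult_distrib power2_eq_square)
      also have "\<dots> \<le> r t"
        unfolding r_def by (intro mult_mono mult_right_mono mult_left_le) auto
      finally show ?thesis .
    qed
    have "integrable lborel (\<lambda>t. f t * j t)"
    proof (rule Bochner_Integration.integrable_bound[where f = "\<lambda>t. N * cmod (f t)"])
      show "AE t in lborel. norm (f t * j t) \<le> norm (N * cmod (f t))"
        using order_trans[OF cmod_j cut] N
        by (auto simp: norm_mult mult.commute[of N] intro!: mult_left_mono)
    qed (use f in auto)
    then have ri: "integrable lborel r"
      unfolding fj complex_of_real_integrable_eq by simp
    have "(LINT t|lborel. (cmod (j t))\<^sup>2) \<le> (LINT t|lborel. r t)"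
      by (intro integral_mono ji2 ri jr)
    also have "\<dots> \<le> cmod (LINT t|lborel. f t * j t)"
      unfolding fj by simp
    \<comment> \<open>Half of the integral of \<open>|j|^2\<close> on the right is absorbed on the
      left, which doubles \<open>A / (4 * pi)\<close>.\<close>
    finally have "(LINT t|lborel. (cmod (j t))\<^sup>2) \<le> 2 * (A / (4 * pi))"
      using le by linarith
    then have "(LINT t|lborel. (cmod (j t))\<^sup>2) \<le> A / (2 * pi)"
      by simp
    moreover have "cmod (j t) = cmod (truncate N (f t)) * cutoff N t" for t
      by (simp add: j_def norm_mult)
    ultimately show ?thesis
      using nn_integral_eq_integral[OF ji2] by (simp add: ennreal_leI)
  qed
  have "(\<integral>\<^sup>+t. ennreal ((cmod (f t))\<^sup>2) \<partial>lborel)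
      = (\<integral>\<^sup>+t. liminf (\<lambda>k. ennreal ((cmod (truncate (real (Suc k)) (f t)) * cutoff (real (Suc k)) t)\<^sup>2)) \<partial>lborel)"
  proof (intro nn_integral_cong lim_imp_Liminf[symmetric])
    fix t
    obtain K where K: "max (cmod (f t)) \<bar>t\<bar> \<le> real K"
      using real_arch_simple by blast
    \<comment> \<open>For fixed \<open>t\<close> truncation and cutoff are inactive for all large
      \<open>k\<close>, so the limit inferior is attained trivially.\<close>
    have "\<forall>\<^sub>F k in sequentially. cmod (truncate (real (Suc k)) (f t)) * cutoff (real (Suc k)) t = cmod (f t)"
      using eventually_ge_at_top[of K]
    proof eventually_elim
      case (elim k)
      then have "cmod (f t) \<le> real (Suc k)" "\<bar>t\<bar> \<le> real (Suc k)"
        using K by (auto simp: max_def split: if_splits)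
      then show ?case
        by (simp add: truncate_eq cutoff_def)
    qed
    then have "\<forall>\<^sub>F k in sequentially.
        ennreal ((cmod (truncate (real (Suc k)) (f t)) * cutoff (real (Suc k)) t)\<^sup>2) = ennreal ((cmod (f t))\<^sup>2)"
      by eventually_elim simp
    then show "(\<lambda>k. ennreal ((cmod (truncate (real (Suc k)) (f t)) * cutoff (real (Suc k)) t)\<^sup>2))
        \<longlonglongrightarrow> ennreal ((cmod (f t))\<^sup>2)"
      by (rule tendsto_eventually)
  qed simp
  also have "\<dots> \<le> liminf (\<lambda>k. \<integral>\<^sup>+t. ennreal ((cmod (truncate (real (Suc k)) (f t)) * cutoff (real (Suc k)) t)\<^sup>2) \<partial>lborel)"
  proof (rule nn_integral_liminf)
    fix k
    have [measurable]: "truncate (real (Suc k)) \<in> borel_measurable borel"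
      by (rule borel_measurable_continuous_onI[OF continuous_on_truncate]) simp
    show "(\<lambda>t. ennreal ((cmod (truncate (real (Suc k)) (f t)) * cutoff (real (Suc k)) t)\<^sup>2)) \<in> borel_measurable lborel"
      by measurable
  qed
  also have "\<dots> \<le> ennreal (A / (2 * pi))"
    by (intro Liminf_le always_eventually allI main) auto
  finally show ?thesis
    unfolding A_def .
qed

section \<open>Norm inequalities in L2\<close>

lemma L2_measurable [measurable_dest]: "f \<in> L2 \<Longrightarrow> f \<in> borel_measurable borel"
  and L2_integrable: "f \<in> L2 \<Longrightarrow> integrable lborel (\<lambda>t. (cmod (f t))\<^sup>2)"
  by (auto simp: L2_def)

lemma L2_norm_nonneg [simp]: "0 \<le> L2_norm f"
  by (simp add: L2_norm_def)

lemma L2_norm_square: "(L2_norm f)\<^sup>2 = (LINT t|lborel. (cmod (f t))\<^sup>2)"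
  by (simp add: L2_norm_def)

lemma cmod_add_square_le: "(cmod (x + y))\<^sup>2 \<le> 2 * (cmod x)\<^sup>2 + 2 * (cmod y)\<^sup>2"
proof -
  have "(cmod (x + y))\<^sup>2 \<le> (cmod x + cmod y)\<^sup>2"
    by (intro power_mono norm_triangle_ineq) simp
  also have "\<dots> \<le> 2 * (cmod x)\<^sup>2 + 2 * (cmod y)\<^sup>2"
    using sum_squares_bound[of "cmod x" "cmod y"] by (simp add: power2_sum)
  finally show ?thesis .
qed

lemma L2_add:
  assumes "f \<in> L2" "g \<in> L2"
  shows "(\<lambda>t. f t + g t) \<in> L2"
proof -
  have "integrable lborel (\<lambda>t. (cmod (f t + g t))\<^sup>2)"
  proof (rule Bochner_Integration.integrable_bound)
    show "integrable lborel (\<lambda>t. 2 * (cmod (f t))\<^sup>2 + 2 * (cmod (g t))\<^sup>2)"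
      using assms by (simp add: L2_integrable)
  qed (use assms cmod_add_square_le in auto)
  moreover have "(\<lambda>t. f t + g t) \<in> borel_measurable borel"
    using assms by measurable
  ultimately show ?thesis
    by (simp add: L2_def)
qed

lemma L2_uminus: "f \<in> L2 \<Longrightarrow> (\<lambda>t. - f t) \<in> L2"
  by (simp add: L2_def)

lemma L2_diff: "f \<in> L2 \<Longrightarrow> g \<in> L2 \<Longrightarrow> (\<lambda>t. f t - g t) \<in> L2"
  using L2_add[OF _ L2_uminus] by fastforce

lemma L2_norm_minus_commute: "L2_norm (\<lambda>t. f t - g t) = L2_norm (\<lambda>t. g t - f t)"
  by (simp add: L2_norm_def norm_minus_commute)

lemma integral_cmod_mult_le:
  assumes f: "f \<in> L2" and g: "g \<in> L2"
  shows "integrable lborel (\<lambda>t. cmod (f t) * cmod (g t))"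
    and "(LINT t|lborel. cmod (f t) * cmod (g t)) \<le> L2_norm f * L2_norm g"
proof -
  let ?P = "LINT t|lborel. cmod (f t) * cmod (g t)"
  show int: "integrable lborel (\<lambda>t. cmod (f t) * cmod (g t))"
  proof (rule Bochner_Integration.integrable_bound)
    show "integrable lborel (\<lambda>t. (cmod (f t))\<^sup>2 + (cmod (g t))\<^sup>2)"
      using f g by (simp add: L2_integrable)
    have "cmod (f t) * cmod (g t) \<le> (cmod (f t))\<^sup>2 + (cmod (g t))\<^sup>2" for t
      using sum_squares_bound[of "cmod (f t)" "cmod (g t)"]
        mult_nonneg_nonneg[OF norm_ge_zero norm_ge_zero, of "f t" "g t"] by linarith
    then show "AE t in lborel. norm (cmod (f t) * cmod (g t)) \<le> norm ((cmod (f t))\<^sup>2 + (cmod (g t))\<^sup>2)"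
      by (auto simp: abs_mult)
  qed (use f g in measurable)
  \<comment> \<open>the quadratic polynomial in \<open>c\<close> given by the integral of \<open>(\<bar>f\<bar> - c \<bar>g\<bar>)\<^sup>2\<close> is nonnegative\<close>
  have quad: "0 \<le> (L2_norm f)\<^sup>2 - 2 * c * ?P + c\<^sup>2 * (L2_norm g)\<^sup>2" for c
  proof -
    have "(LINT t|lborel. (cmod (f t))\<^sup>2 - 2 * c * (cmod (f t) * cmod (g t)) + c\<^sup>2 * (cmod (g t))\<^sup>2)
        = (L2_norm f)\<^sup>2 - 2 * c * ?P + c\<^sup>2 * (L2_norm g)\<^sup>2"
      using f g int by (simp add: L2_norm_square L2_integrable)
    moreover have "(cmod (f t))\<^sup>2 - 2 * c * (cmod (f t) * cmod (g t)) + c\<^sup>2 * (cmod (g t))\<^sup>2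
        = (cmod (f t) - c * cmod (g t))\<^sup>2" for t
      by (simp add: power2_diff power_mult_distrib)
    ultimately show ?thesis
      by (metis (no_types, lifting) Bochner_Integration.integral_nonneg zero_le_power2)
  qed
  show "?P \<le> L2_norm f * L2_norm g"
  proof (cases "L2_norm g = 0")
    case True
    have "?P \<le> 0"
    proof (rule ccontr)
      assume "\<not> ?P \<le> 0"
      \<comment> \<open>The quadratic is now linear in \<open>c\<close>, and this \<open>c\<close>
        gives it the value \<open>-1\<close>.\<close>
      then show False
        using quad[of "((L2_norm f)\<^sup>2 + 1) / (2 * ?P)"] True by (simp add: field_simps)
    qed
    with True show ?thesis by simp
  next
    case False
    then have "0 < L2_norm g"
      using L2_norm_nonneg[of g] by linarith
    \<comment> \<open>This \<open>c\<close> minimises the quadratic; nonnegativity of the minimum is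
      the squared inequality.\<close>
    with quad[of "?P / (L2_norm g)\<^sup>2"] have "?P\<^sup>2 \<le> (L2_norm f * L2_norm g)\<^sup>2"
      by (simp add: field_simps power2_eq_square)
    then show ?thesis
      by (rule power2_le_imp_le) simp
  qed
qed

lemma L2_norm_triangle:
  assumes f: "f \<in> L2" and g: "g \<in> L2"
  shows "L2_norm (\<lambda>t. f t + g t) \<le> L2_norm f + L2_norm g"
proof (rule power2_le_imp_le)
  have "(L2_norm (\<lambda>t. f t + g t))\<^sup>2
      \<le> (LINT t|lborel. (cmod (f t))\<^sup>2 + 2 * (cmod (f t) * cmod (g t)) + (cmod (g t))\<^sup>2)"
    unfolding L2_norm_square
  proof (rule integral_mono)
    fix t
    have "(cmod (f t + g t))\<^sup>2 \<le> (cmod (f t) + cmod (g t))\<^sup>2"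
      by (intro power_mono norm_triangle_ineq) simp
    then show "(cmod (f t + g t))\<^sup>2 \<le> (cmod (f t))\<^sup>2 + 2 * (cmod (f t) * cmod (g t)) + (cmod (g t))\<^sup>2"
      by (simp add: power2_sum)
  qed (use f g L2_add integral_cmod_mult_le in \<open>auto simp: L2_integrable\<close>)
  also have "\<dots> = (L2_norm f)\<^sup>2 + 2 * (LINT t|lborel. cmod (f t) * cmod (g t)) + (L2_norm g)\<^sup>2"
    using f g integral_cmod_mult_le(1)[OF f g] by (simp add: L2_norm_square L2_integrable)
  also have "\<dots> \<le> (L2_norm f + L2_norm g)\<^sup>2"
    using integral_cmod_mult_le(2)[OF f g] by (simp add: power2_sum)
  finally show "(L2_norm (\<lambda>t. f t + g t))\<^sup>2 \<le> (L2_norm f + L2_norm g)\<^sup>2" .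
qed simp

lemma L2_norm_tendsto:
  assumes \<phi>: "\<And>k. \<phi> k \<in> L2" and f: "f \<in> L2"
    and lim: "(\<lambda>k. L2_norm (\<lambda>t. \<phi> k t - f t)) \<longlonglongrightarrow> 0"
  shows "(\<lambda>k. L2_norm (\<phi> k)) \<longlonglongrightarrow> L2_norm f"
proof -
  have "\<bar>L2_norm (\<phi> k) - L2_norm f\<bar> \<le> L2_norm (\<lambda>t. \<phi> k t - f t)" for k
  proof -
    have "L2_norm (\<phi> k) \<le> L2_norm (\<lambda>t. \<phi> k t - f t) + L2_norm f"
      using L2_norm_triangle[OF L2_diff[OF \<phi> f] f, of k] by simp
    moreover have "L2_norm f \<le> L2_norm (\<lambda>t. f t - \<phi> k t) + L2_norm (\<phi> k)"
      using L2_norm_triangle[OF L2_diff[OF f \<phi>] \<phi>, of k k] by simp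
    ultimately show ?thesis
      by (simp add: L2_norm_minus_commute)
  qed
  then have "(\<lambda>k. L2_norm (\<phi> k) - L2_norm f) \<longlonglongrightarrow> 0"
    by (intro Lim_null_comparison[OF always_eventually lim]) auto
  then show ?thesis
    by (simp add: LIM_zero_iff)
qed

section \<open>Plancherel's identity and uniqueness for the L2 extension\<close>

lemma L2_norm_fourier:
  assumes f: "integrable lborel f" "f \<in> L2"
  shows "L2_norm (fourier f) = sqrt (2 * pi) * L2_norm f"
proof -
  note F = fourier_square_integrable[OF f(1) L2_integrable[OF f(2)]]
  have "(LINT t|lborel. (cmod (f t))\<^sup>2) \<le> (LINT s|lborel. (cmod (fourier f s))\<^sup>2) / (2 * pi)"
    using integral_cmod_square_le_fourier[OF f(1) F(1)]
    by (simp add: nn_integral_eq_integral[OF L2_integrable[OF f(2)]])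
  then have "2 * pi * (LINT t|lborel. (cmod (f t))\<^sup>2) \<le> (LINT s|lborel. (cmod (fourier f s))\<^sup>2)"
    by (simp add: field_simps)
  with F(2) have "(LINT s|lborel. (cmod (fourier f s))\<^sup>2) = 2 * pi * (LINT t|lborel. (cmod (f t))\<^sup>2)"
    by (rule antisym)
  then show ?thesis
    by (simp add: L2_norm_def real_sqrt_mult)
qed

text \<open>The identity on L1 \<inter> L2 passes to the limit, since both approximations in
  \<open>fourier_L2\<close> converge in norm.\<close>

theorem L2_norm_fourier_L2:
  assumes "fourier_L2 f g"
  shows "L2_norm g = sqrt (2 * pi) * L2_norm f"
proof -
  from assms obtain \<phi> where f: "f \<in> L2" and g: "g \<in> L2"
    and \<phi>: "\<And>k. integrable lborel (\<phi> k)" "\<And>k. \<phi> k \<in> L2" "\<And>k. fourier (\<phi> k) \<in> L2"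
    and lim: "(\<lambda>k. L2_norm (\<lambda>t. \<phi> k t - f t)) \<longlonglongrightarrow> 0"
      "(\<lambda>k. L2_norm (\<lambda>s. fourier (\<phi> k) s - g s)) \<longlonglongrightarrow> 0"
    unfolding fourier_L2_def by auto
  have "(\<lambda>k. L2_norm (fourier (\<phi> k))) \<longlonglongrightarrow> sqrt (2 * pi) * L2_norm f"
    unfolding L2_norm_fourier[OF \<phi>(1,2)]
    by (intro tendsto_intros L2_norm_tendsto[OF \<phi>(2) f lim(1)])
  with L2_norm_tendsto[OF \<phi>(3) g lim(2)] show ?thesis
    by (rule LIMSEQ_unique)
qed

lemma L2_norm_diff_tendsto_0:
  assumes "\<And>k. \<phi> k \<in> L2" "f \<in> L2" "\<And>k. \<psi> k \<in> L2" "g \<in> L2"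
    and "(\<lambda>k. L2_norm (\<lambda>t. \<phi> k t - f t)) \<longlonglongrightarrow> 0" "(\<lambda>k. L2_norm (\<lambda>t. \<psi> k t - g t)) \<longlonglongrightarrow> 0"
  shows "(\<lambda>k. L2_norm (\<lambda>t. (\<phi> k t - \<psi> k t) - (f t - g t))) \<longlonglongrightarrow> 0"
proof (rule Lim_null_comparison)
  have "L2_norm (\<lambda>t. (\<phi> k t - \<psi> k t) - (f t - g t))
      \<le> L2_norm (\<lambda>t. \<phi> k t - f t) + L2_norm (\<lambda>t. \<psi> k t - g t)" for k
  proof -
    have "L2_norm (\<lambda>t. (\<phi> k t - f t) + (g t - \<psi> k t))
        \<le> L2_norm (\<lambda>t. \<phi> k t - f t) + L2_norm (\<lambda>t. g t - \<psi> k t)"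
      by (intro L2_norm_triangle L2_diff assms)
    then show ?thesis
      by (simp add: L2_norm_minus_commute[of g] algebra_simps)
  qed
  then show "\<forall>\<^sub>F k in sequentially. norm (L2_norm (\<lambda>t. (\<phi> k t - \<psi> k t) - (f t - g t)))
      \<le> L2_norm (\<lambda>t. \<phi> k t - f t) + L2_norm (\<lambda>t. \<psi> k t - g t)"
    by simp
  show "(\<lambda>k. L2_norm (\<lambda>t. \<phi> k t - f t) + L2_norm (\<lambda>t. \<psi> k t - g t)) \<longlonglongrightarrow> 0"
    using tendsto_add[OF assms(5,6)] by simp
qed

lemma fourier_diff:
  assumes "integrable lborel f" "integrable lborel g"
  shows "fourier (\<lambda>t. f t - g t) s = fourier f s - fourier g s"
  unfolding fourier_def
  using integrable_fourier_kernel[OF assms(1)] integrable_fourier_kernel[OF assms(2)]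
  by (simp add: left_diff_distrib)

text \<open>Approximating sequences are subtracted termwise. This exhibits the difference of two
  outputs as one function with a known transform.\<close>

lemma fourier_L2_diff:
  assumes "fourier_L2 f g" "fourier_L2 f' g'"
  shows "fourier_L2 (\<lambda>t. f t - f' t) (\<lambda>s. g s - g' s)"
proof -
  from assms(1) obtain \<phi> where f: "f \<in> L2" "g \<in> L2"
    and \<phi>: "\<And>k. integrable lborel (\<phi> k)" "\<And>k. \<phi> k \<in> L2" "\<And>k. fourier (\<phi> k) \<in> L2"
      "(\<lambda>k. L2_norm (\<lambda>t. \<phi> k t - f t)) \<longlonglongrightarrow> 0"
      "(\<lambda>k. L2_norm (\<lambda>s. fourier (\<phi> k) s - g s)) \<longlonglongrightarrow> 0"
    unfolding fourier_L2_def by auto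
  from assms(2) obtain \<psi> where f': "f' \<in> L2" "g' \<in> L2"
    and \<psi>: "\<And>k. integrable lborel (\<psi> k)" "\<And>k. \<psi> k \<in> L2" "\<And>k. fourier (\<psi> k) \<in> L2"
      "(\<lambda>k. L2_norm (\<lambda>t. \<psi> k t - f' t)) \<longlonglongrightarrow> 0"
      "(\<lambda>k. L2_norm (\<lambda>s. fourier (\<psi> k) s - g' s)) \<longlonglongrightarrow> 0"
    unfolding fourier_L2_def by auto
  have eq: "fourier (\<lambda>t. \<phi> k t - \<psi> k t) = (\<lambda>s. fourier (\<phi> k) s - fourier (\<psi> k) s)" for k
    by (simp add: fun_eq_iff fourier_diff \<phi> \<psi>)
  show ?thesis
    unfolding fourier_L2_def
  proof (intro conjI exI[of _ "\<lambda>k t. \<phi> k t - \<psi> k t"] allI)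
    show "(\<lambda>k. L2_norm (\<lambda>t. \<phi> k t - \<psi> k t - (f t - f' t))) \<longlonglongrightarrow> 0"
      by (intro L2_norm_diff_tendsto_0 f f' \<phi> \<psi>)
    show "(\<lambda>k. L2_norm (\<lambda>s. fourier (\<lambda>t. \<phi> k t - \<psi> k t) s - (g s - g' s))) \<longlonglongrightarrow> 0"
      unfolding eq by (intro L2_norm_diff_tendsto_0 f f' \<phi> \<psi>)
  qed (auto simp: eq intro!: L2_diff f f' \<phi> \<psi>)
qed

lemma L2_norm_eq_0_AE:
  assumes "f \<in> L2" "L2_norm f = 0"
  shows "AE t in lborel. f t = 0"
proof -
  have "AE t in lborel. (cmod (f t))\<^sup>2 = 0"
    using assms integral_nonneg_eq_0_iff_AE[OF L2_integrable[OF assms(1)]]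
    by (simp add: L2_norm_def)
  then show ?thesis by simp
qed

text \<open>\<open>g - g'\<close> is a transform of the zero function, so its norm is 0. This
  identifies the representatives of the input's transform that different output relations
  provide.\<close>

lemma fourier_L2_unique:
  assumes "fourier_L2 f g" "fourier_L2 f g'"
  shows "AE s in lborel. g s = g' s"
proof -
  have "L2_norm (\<lambda>s. g s - g' s) = 0"
    using L2_norm_fourier_L2[OF fourier_L2_diff[OF assms]] by (simp add: L2_norm_def)
  moreover have "(\<lambda>s. g s - g' s) \<in> L2"
    using fourier_L2_diff[OF assms] by (simp add: fourier_L2_def)
  ultimately have "AE s in lborel. g s - g' s = 0"
    by (intro L2_norm_eq_0_AE)
  then show ?thesis by simp
qed

section \<open>The transfer functions\<close>

\<comment> \<open>otherwise the simplifier turns \<open>carrier_mat n 1\<close> into \<open>carrier_mat n (Suc 0)\<close>\<close>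
declare One_nat_def [simp del]

section \<open>Explicit resolvent vectors of \<open>A_H\<close> and \<open>A_H_perp\<close>\<close>

definition legs_prod :: "nat \<Rightarrow> complex \<Rightarrow> complex" where
  "legs_prod n s = (\<Prod>k<n. (s - of_nat k) / (s + of_nat k + 1))"

lemma legs_prod_0 [simp]: "legs_prod 0 s = 1"
  and legs_prod_Suc: "legs_prod (Suc n) s = legs_prod n s * ((s - of_nat n) / (s + of_nat n + 1))"
  by (simp_all add: legs_prod_def)

lemma of_nat_shift_nonzero: "0 \<le> Re s \<Longrightarrow> s + of_nat k + 1 \<noteq> 0"
  by (auto simp: complex_eq_iff)

text \<open>Telescoping: \<open>p_k - p_(k+1) = (2k+1) p_k / (s+k+1)\<close>, where the assumption
  on \<open>s\<close> keeps the denominators nonzero.\<close>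

lemma sum_legs_prod:
  assumes "0 \<le> Re s"
  shows "(\<Sum>k<i. (2 * of_nat k + 1) * (legs_prod k s / (s + of_nat k + 1))) = 1 - legs_prod i s"
proof (induction i)
  case (Suc i)
  have "s + of_nat i + 1 \<noteq> 0"
    by (rule of_nat_shift_nonzero[OF assms])
  then have "legs_prod (Suc i) s
      = legs_prod i s - (2 * of_nat i + 1) * (legs_prod i s / (s + of_nat i + 1))"
    by (simp add: legs_prod_Suc field_simps)
  with Suc show ?case by simp
qed simp

text \<open>The vector \<open>(s - A_H)^-1 B_H\<close> from forward substitution in the triangular
  system, verified below for \<open>0 \<le> Re s\<close>.\<close>

definition legs_state :: "nat \<Rightarrow> complex \<Rightarrow> complex mat" where
  "legs_state n s = Matrix.mat n 1 (\<lambda>(i, _).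
     complex_of_real (sqrt (2 * real i + 1)) * (legs_prod i s / (complex_of_real (sqrt 2) * (s + of_nat i + 1))))"

abbreviation A_Hc :: "nat \<Rightarrow> complex mat" where
  "A_Hc n \<equiv> map_mat complex_of_real (A_H n)"

abbreviation A_H_perpc :: "nat \<Rightarrow> complex mat" where
  "A_H_perpc n \<equiv> map_mat complex_of_real (A_H_perp n)"

abbreviation s_minus :: "nat \<Rightarrow> complex \<Rightarrow> complex mat \<Rightarrow> complex mat" where
  "s_minus n s A \<equiv> s \<cdot>\<^sub>m 1\<^sub>m n - A"

lemma carriers [simp]:
  "A_H n \<in> carrier_mat n n" "B_H n \<in> carrier_mat n 1" "A_H_perp n \<in> carrier_mat n n"
  "legs_state n s \<in> carrier_mat n 1"
  by (auto simp: A_H_def B_H_def A_H_perp_def legs_state_def)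

lemma dims [simp]:
  "dim_row (A_H n) = n" "dim_col (A_H n) = n" "dim_row (B_H n) = n" "dim_col (B_H n) = 1"
  "dim_row (A_H_perp n) = n" "dim_col (A_H_perp n) = n"
  "dim_row (legs_state n s) = n" "dim_col (legs_state n s) = 1"
  using carriers by (metis carrier_matD)+

lemma index_mult_sum:
  assumes "i < dim_row A" "j < dim_col B" "dim_col A = dim_row B"
  shows "(A * B) $$ (i, j) = (\<Sum>k<dim_row B. A $$ (i, k) * B $$ (k, j))"
  using assms by (simp add: scalar_prod_def lessThan_atLeast0)

lemma of_real_sqrt_sqrt: "0 \<le> x \<Longrightarrow> complex_of_real (sqrt x) * complex_of_real (sqrt x) = complex_of_real x"
  by (simp flip: of_real_mult)

lemma sqrt_mult_legs_state:
  assumes "k < n"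
  shows "complex_of_real (sqrt (2 * real k + 1)) * legs_state n s $$ (k, 0)
    = (2 * of_nat k + 1) * (legs_prod k s / (s + of_nat k + 1)) / complex_of_real (sqrt 2)"
proof -
  have "complex_of_real (sqrt (2 * real k + 1)) * legs_state n s $$ (k, 0)
     = (complex_of_real (sqrt (2 * real k + 1)) * complex_of_real (sqrt (2 * real k + 1)))
       * (legs_prod k s / (s + of_nat k + 1)) / complex_of_real (sqrt 2)"
    using assms by (simp add: legs_state_def mult_ac)
  then show ?thesis
    by (subst (asm) of_real_sqrt_sqrt) auto
qed

text \<open>In row \<open>i\<close> the diagonal term contributes the share \<open>p_i\<close> of
  the entry of \<open>B_H\<close>, and the terms to its left telescope to the share
  \<open>1 - p_i\<close>.\<close>

lemma legs_state_solves:
  assumes s: "0 \<le> Re s"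
  shows "s_minus n s (A_Hc n) * legs_state n s = B_Hc n"
proof (rule eq_matI)
  fix i j assume "i < dim_row (B_Hc n)" "j < dim_col (B_Hc n)"
  then have i: "i < n" and j: "j = 0" by auto
  let ?r = "\<lambda>k. complex_of_real (sqrt (2 * real k + 1))"
  let ?x = "\<lambda>k. legs_state n s $$ (k, 0)"
  have "(s_minus n s (A_Hc n) * legs_state n s) $$ (i, 0)
      = (\<Sum>k<n. s_minus n s (A_Hc n) $$ (i, k) * ?x k)"
    using i by (subst index_mult_sum) auto
  also have "\<dots> = (\<Sum>k<n. (if k = i then (s + of_nat i + 1) * ?x i else 0)
      + (if k < i then ?r i * (?r k * ?x k) else 0))"
    using i by (intro sum.cong) (auto simp: A_H_def mult_ac)
  also have "\<dots> = (s + of_nat i + 1) * ?x i + (\<Sum>k<n. if k < i then ?r i * (?r k * ?x k) else 0)"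
    using i by (simp add: sum.distrib)
  also have "(\<Sum>k<n. if k < i then ?r i * (?r k * ?x k) else 0) = (\<Sum>k<i. ?r i * (?r k * ?x k))"
    using i by (intro sum.mono_neutral_cong_right) auto
  also have "\<dots> = ?r i * ((1 - legs_prod i s) / complex_of_real (sqrt 2))"
    using i by (simp add: sqrt_mult_legs_state sum_legs_prod[OF s, symmetric] sum_distrib_left sum_divide_distrib)
  also have "(s + of_nat i + 1) * ?x i = ?r i * (legs_prod i s / complex_of_real (sqrt 2))"
  proof -
    have "t * (r * (p / (c * t))) = r * (p / c)" if "t \<noteq> 0" for t r p c :: complex
      using that by simp
    from this[OF of_nat_shift_nonzero[OF s, of i]] show ?thesis
      using i unfolding legs_state_def by simp
  qed
  also have "?r i * (legs_prod i s / complex_of_real (sqrt 2))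
      + ?r i * ((1 - legs_prod i s) / complex_of_real (sqrt 2)) = B_Hc n $$ (i, 0)"
    using i by (simp add: B_H_def real_sqrt_divide add_divide_distrib[symmetric] distrib_left[symmetric] del: distrib_left_numeral)
  finally show "(s_minus n s (A_Hc n) * legs_state n s) $$ (i, j) = B_Hc n $$ (i, j)"
    using j by simp
qed auto

text \<open>The same telescoping over all \<open>n\<close> coordinates. Both \<open>B_H\<close> and
  the state carry a factor \<open>1 / sqrt 2\<close>, hence the \<open>1/2\<close>.\<close>

lemma B_Hc_mult_legs_state:
  assumes s: "0 \<le> Re s"
  shows "(\<Sum>k<n. B_Hc n $$ (k, 0) * legs_state n s $$ (k, 0)) = (1 - legs_prod n s) / 2"
proof -
  have "(\<Sum>k<n. B_Hc n $$ (k, 0) * legs_state n s $$ (k, 0))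
     = (\<Sum>k<n. (complex_of_real (sqrt (2 * real k + 1)) * legs_state n s $$ (k, 0)) / complex_of_real (sqrt 2))"
    by (intro sum.cong) (auto simp: B_H_def real_sqrt_divide)
  also have "\<dots> = (\<Sum>k<n. (2 * of_nat k + 1) * (legs_prod k s / (s + of_nat k + 1)) / 2)"
  proof -
    have "z / complex_of_real (sqrt 2) / complex_of_real (sqrt 2) = z / 2" for z
      by (subst divide_divide_eq_left) (simp add: of_real_sqrt_sqrt del: divide_divide_eq_left)
    then show ?thesis
      by (intro sum.cong refl) (simp only: sqrt_mult_legs_state lessThan_iff)
  qed
  also have "\<dots> = (1 - legs_prod n s) / 2"
    by (simp add: sum_legs_prod[OF s, symmetric] sum_divide_distrib)
  finally show ?thesis .
qed

text \<open>The Sherman-Morrison formula for the perturbation \<open>b b^T\<close> of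
  \<open>A_H\<close>: the state \<open>x\<close> is divided by
  \<open>1 - b^T x = (1 + p)/2\<close>.\<close>

definition legs_state_perp :: "nat \<Rightarrow> complex \<Rightarrow> complex mat" where
  "legs_state_perp n s = (2 / (1 + legs_prod n s)) \<cdot>\<^sub>m legs_state n s"

lemma legs_state_perp_carrier [simp]: "legs_state_perp n s \<in> carrier_mat n 1"
  unfolding legs_state_perp_def by (intro smult_carrier_mat carriers)

lemma A_H_perpc_eq: "A_H_perpc n = A_Hc n + B_Hc n * transpose_mat (B_Hc n)"
  by (rule eq_matI) (auto simp: A_H_perp_def scalar_prod_def)

lemma index_A_H_perp:
  assumes "i < n" "k < n"
  shows "A_H_perp n $$ (i, k) = A_H n $$ (i, k) + B_H n $$ (i, 0) * B_H n $$ (k, 0)"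
  using assms by (simp add: A_H_perp_def scalar_prod_def One_nat_def)

lemma legs_state_perp_solves:
  assumes s: "0 \<le> Re s" and p: "legs_prod n s \<noteq> -1"
  shows "s_minus n s (A_H_perpc n) * legs_state_perp n s = B_Hc n"
proof (rule eq_matI)
  fix i j assume "i < dim_row (B_Hc n)" "j < dim_col (B_Hc n)"
  then have i: "i < n" and j: "j = 0" by auto
  let ?x = "\<lambda>k. legs_state n s $$ (k, 0)" and ?b = "\<lambda>k. B_Hc n $$ (k, 0)"
  have p0: "1 + legs_prod n s \<noteq> 0"
    using p by (metis add.commute add_eq_0_iff)
  have "(s_minus n s (A_H_perpc n) * legs_state_perp n s) $$ (i, 0)
      = (\<Sum>k<n. s_minus n s (A_H_perpc n) $$ (i, k) * legs_state_perp n s $$ (k, 0))"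
    using i by (subst index_mult_sum) (auto simp: legs_state_perp_def)
  also have "\<dots> = (\<Sum>k<n. 2 / (1 + legs_prod n s) * (s_minus n s (A_Hc n) $$ (i, k) * ?x k - ?b i * (?b k * ?x k)))"
    using i by (intro sum.cong) (auto simp: legs_state_perp_def index_A_H_perp algebra_simps)
  also have "\<dots> = 2 / (1 + legs_prod n s) * ((\<Sum>k<n. s_minus n s (A_Hc n) $$ (i, k) * ?x k) - ?b i * (\<Sum>k<n. ?b k * ?x k))"
    by (simp only: sum_distrib_left[symmetric] sum_subtractf)
  also have "(\<Sum>k<n. s_minus n s (A_Hc n) $$ (i, k) * ?x k) = (s_minus n s (A_Hc n) * legs_state n s) $$ (i, 0)"
    using i by (subst index_mult_sum) auto
  also have "\<dots> = ?b i"
    by (simp only: legs_state_solves[OF s])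
  also have "2 / (1 + legs_prod n s) * (?b i - ?b i * (\<Sum>k<n. ?b k * ?x k)) = ?b i"
  proof -
    have "?b i - ?b i * ((1 - legs_prod n s) / 2) = ?b i * ((1 + legs_prod n s) / 2)"
      by (simp add: field_simps)
    then show ?thesis
      unfolding B_Hc_mult_legs_state[OF s] by (simp only: times_divide_times_eq) (simp add: p0)
  qed
  finally show "(s_minus n s (A_H_perpc n) * legs_state_perp n s) $$ (i, j) = B_Hc n $$ (i, j)"
    using j by simp
qed (auto simp: legs_state_perp_def)

section \<open>Matrix inverses and change of basis\<close>

text \<open>A nonzero determinant makes \<open>mat_inverse\<close> return \<open>Some\<close>, so
  that \<open>the\<close> yields a genuine inverse.\<close>

lemma minv:
  assumes M: "M \<in> carrier_mat n n" and det: "Determinant.det M \<noteq> 0"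
  shows "minv M \<in> carrier_mat n n" "minv M * M = 1\<^sub>m n" "M * minv M = 1\<^sub>m n"
proof -
  obtain N where "mat_inverse M = Some N"
    using mat_inverse(1)[OF M, where b = "()"] det_non_zero_imp_unit[OF M det, where b = "()"] by fastforce
  with mat_inverse(2)[OF M this]
  show "minv M \<in> carrier_mat n n" "minv M * M = 1\<^sub>m n" "M * minv M = 1\<^sub>m n"
    by auto
qed

lemma minv_mult_eq:
  assumes M: "M \<in> carrier_mat n n" and det: "Determinant.det M \<noteq> 0"
    and X: "X \<in> carrier_mat n m" and eq: "M * X = Y"
  shows "minv M * Y = X"
proof -
  have "minv M * Y = (minv M * M) * X"
    unfolding eq[symmetric] by (rule assoc_mult_mat[symmetric, OF minv(1)[OF M det] M X])
  then show ?thesis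
    using X by (simp add: minv[OF M det])
qed

lemma det_nonzero_of_right_inverse:
  assumes "V \<in> carrier_mat n n" "U \<in> carrier_mat n n" "V * U = 1\<^sub>m n"
  shows "Determinant.det V \<noteq> (0 :: complex)" "Determinant.det U \<noteq> (0 :: complex)"
  using det_mult[OF assms(1,2)] assms(3) by auto

lemma s_minus_similar:
  assumes U: "U \<in> carrier_mat n n" and V: "V \<in> carrier_mat n n" and UV: "U * V = 1\<^sub>m n"
    and A: "A \<in> carrier_mat n n"
  shows "s_minus n s (U * A * V) = U * s_minus n s A * V"
proof -
  have "U * s_minus n s A * V = (U * (s \<cdot>\<^sub>m 1\<^sub>m n) - U * A) * V"
    using U A by (subst mult_minus_distrib_mat) auto
  also have "\<dots> = U * (s \<cdot>\<^sub>m 1\<^sub>m n) * V - U * A * V"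
    using U A V by (subst minus_mult_distrib_mat) auto
  also have "U * (s \<cdot>\<^sub>m 1\<^sub>m n) * V = s \<cdot>\<^sub>m (U * V)"
    using U by (subst mult_smult_distrib[OF U one_carrier_mat])
      (simp add: mult_smult_assoc_mat[OF U V])
  finally show ?thesis
    by (simp add: UV)
qed

text \<open>A change of basis leaves the transfer function unchanged. Any solution \<open>X\<close>
  of the linear system stands in for the resolvent applied to \<open>B\<close>, so no inverse has to
  be computed.\<close>

lemma transfer_similar:
  assumes U: "U \<in> carrier_mat n n" and V: "V \<in> carrier_mat n n"
    and UV: "U * V = 1\<^sub>m n" and VU: "V * U = 1\<^sub>m n"
    and A: "A \<in> carrier_mat n n" and C: "C \<in> carrier_mat 1 n" and X: "X \<in> carrier_mat n 1"
    and det: "Determinant.det (s_minus n s A) \<noteq> 0" and eq: "s_minus n s A * X = B"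
  shows "transfer (U * A * V) (U * B) (C * V) D s = (C * X) $$ (0, 0) + D"
proof -
  let ?M = "s_minus n s (U * A * V)"
  have sA: "s_minus n s A \<in> carrier_mat n n" using A by auto
  have M: "?M \<in> carrier_mat n n" using U A V by auto
  have M_eq: "?M = U * s_minus n s A * V"
    by (rule s_minus_similar[OF U V UV A])
  have "Determinant.det ?M \<noteq> 0"
    unfolding M_eq using det det_nonzero_of_right_inverse[OF V U VU]
    by (simp add: det_mult[OF mult_carrier_mat[OF U sA] V] det_mult[OF U sA])
  moreover have "?M * (U * X) = U * B"
  proof -
    have "?M * (U * X) = U * s_minus n s A * (V * (U * X))"
      unfolding M_eq by (rule assoc_mult_mat[OF mult_carrier_mat[OF U sA] V mult_carrier_mat[OF U X]])
    also have "V * (U * X) = X"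
      using X by (simp add: assoc_mult_mat[OF V U X, symmetric] VU)
    also have "U * s_minus n s A * X = U * B"
      unfolding eq[symmetric] by (rule assoc_mult_mat[OF U sA X])
    finally show ?thesis .
  qed
  ultimately have inv: "minv ?M * (U * B) = U * X"
    using M mult_carrier_mat[OF U X] by (intro minv_mult_eq)
  have B: "B \<in> carrier_mat n 1" unfolding eq[symmetric] using sA X by auto
  have "C * V * minv ?M * (U * B) = C * V * (minv ?M * (U * B))"
    by (rule assoc_mult_mat[OF mult_carrier_mat[OF C V] minv(1)[OF M \<open>Determinant.det ?M \<noteq> 0\<close>] mult_carrier_mat[OF U B]])
  also have "\<dots> = C * (V * (U * X))"
    unfolding inv by (rule assoc_mult_mat[OF C V mult_carrier_mat[OF U X]])
  also have "V * (U * X) = X"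
    using X by (simp add: assoc_mult_mat[OF V U X, symmetric] VU)
  finally show ?thesis
    unfolding transfer_def using U A V by simp
qed

lemma det_s_minus_A_Hc:
  assumes s: "0 \<le> Re s"
  shows "Determinant.det (s_minus n s (A_Hc n)) \<noteq> 0"
proof -
  have "Determinant.det (s_minus n s (A_Hc n)) = prod_list (diag_mat (s_minus n s (A_Hc n)))"
    by (rule det_lower_triangular[of n]) (auto simp: A_H_def)
  also have "\<dots> = (\<Prod>i = 0..<n. s + of_nat i + 1)"
    unfolding prod_list_diag_prod by (auto simp: A_H_def intro!: prod.cong)
  also have "\<dots> \<noteq> 0"
    using of_nat_shift_nonzero[OF s] by auto
  finally show ?thesis .
qed

section \<open>The eigenbasis of \<open>A_H_perp\<close>\<close>

lemma index_mat_adjoint: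
  assumes "V \<in> carrier_mat n n" "i < n" "j < n"
  shows "mat_adjoint V $$ (i, j) = cnj (V $$ (j, i))"
  using assms by (simp add: mat_adjoint_def mat_of_rows_def)

lemma mat_adjoint_carrier: "V \<in> carrier_mat n n \<Longrightarrow> mat_adjoint V \<in> carrier_mat n n"
  by (simp add: mat_adjoint_def mat_of_rows_def)

lemma unitary_minv:
  assumes "unitary_mat n V"
  shows "minv V = mat_adjoint V"
proof -
  have V: "V \<in> carrier_mat n n" and VV: "V * mat_adjoint V = 1\<^sub>m n"
    using assms by (auto simp: unitary_mat_def)
  note V' = mat_adjoint_carrier[OF V]
  have det: "Determinant.det V \<noteq> 0"
    by (rule det_nonzero_of_right_inverse[OF V V' VV])
  from minv_mult_eq[OF V det V' VV] show ?thesis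
    using minv(1)[OF V det] by simp
qed

lemma diagonalizesD:
  assumes "diagonalizes_A_H_perp n V \<Lambda>"
  shows "V \<in> carrier_mat n n" "minv V \<in> carrier_mat n n" "minv V * V = 1\<^sub>m n" "V * minv V = 1\<^sub>m n"
    "minv V = mat_adjoint V" "\<Lambda> \<in> carrier_mat n n" "diagonal_mat \<Lambda>" "\<Lambda> = minv V * A_H_perpc n * V"
proof -
  have u: "unitary_mat n V" and L: "\<Lambda> \<in> carrier_mat n n" "diagonal_mat \<Lambda>"
    and eq: "A_H_perpc n = V * \<Lambda> * minv V"
    using assms by (auto simp: diagonalizes_A_H_perp_def)
  have V: "V \<in> carrier_mat n n" and VV: "V * mat_adjoint V = 1\<^sub>m n" "mat_adjoint V * V = 1\<^sub>m n"
    using u by (auto simp: unitary_mat_def)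
  note U = mat_adjoint_carrier[OF V]
  note minv = unitary_minv[OF u]
  have "mat_adjoint V * A_H_perpc n * V = mat_adjoint V * V * \<Lambda> * (mat_adjoint V * V)"
    unfolding eq minv using V U L by (simp add: assoc_mult_mat[where n\<^sub>1 = n and n\<^sub>2 = n and n\<^sub>3 = n and n\<^sub>4 = n])
  also have "\<dots> = \<Lambda>"
    using L by (simp add: VV)
  finally show "\<Lambda> = minv V * A_H_perpc n * V"
    by (simp add: minv)
  show "V \<in> carrier_mat n n" "minv V \<in> carrier_mat n n" "minv V * V = 1\<^sub>m n" "V * minv V = 1\<^sub>m n"
    "minv V = mat_adjoint V" "\<Lambda> \<in> carrier_mat n n" "diagonal_mat \<Lambda>"
    using V VV U L minv by auto
qed

text \<open>The symmetric part of \<open>A_H_perp\<close> is \<open>-1/2\<close> times the identity, so its spectrum lies on \<open>Re = -1/2\<close>.\<close>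

lemma Re_eigenvalue:
  assumes d: "diagonalizes_A_H_perp n V \<Lambda>" and i: "i < n"
  shows "Re (\<Lambda> $$ (i, i)) = -1/2"
proof -
  note D = diagonalizesD[OF d]
  let ?v = "\<lambda>j. V $$ (j, i)" and ?A = "\<lambda>j k. A_H_perp n $$ (j, k)"
  \<comment> \<open>Since \<open>minv V\<close> is the adjoint, the diagonal entry is the quadratic
    form of \<open>A_H_perp\<close> at column \<open>i\<close> of \<open>V\<close>. Conjugation
    exchanges the two indices, so adding the conjugate leaves only the symmetric part.\<close>
  have L: "\<Lambda> $$ (i, i) = (\<Sum>k<n. \<Sum>j<n. cnj (?v j) * complex_of_real (?A j k) * ?v k)"
  proof -
    have "\<Lambda> $$ (i, i) = (\<Sum>k<n. (minv V * A_H_perpc n) $$ (i, k) * ?v k)"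
      unfolding D(8) using D(1,2) i by (subst index_mult_sum) auto
    also have "\<dots> = (\<Sum>k<n. (\<Sum>j<n. cnj (?v j) * complex_of_real (?A j k)) * ?v k)"
      using D(1,2) i by (intro sum.cong refl, subst index_mult_sum)
        (auto simp: D(5) index_mat_adjoint[OF D(1)])
    finally show ?thesis
      by (simp add: sum_distrib_right)
  qed
  have sym: "?A j k + ?A k j = (if j = k then -1 else 0)" if "j < n" "k < n" for j k
    using that by (auto simp: A_H_perp_explicit)
  have cL: "cnj (\<Lambda> $$ (i, i)) = (\<Sum>j<n. \<Sum>k<n. cnj (?v k) * complex_of_real (?A j k) * ?v j)"
    unfolding L by (subst sum.swap) (simp add: mult_ac)
  have "\<Lambda> $$ (i, i) + cnj (\<Lambda> $$ (i, i))
      = (\<Sum>k<n. \<Sum>j<n. cnj (?v j) * complex_of_real (?A j k + ?A k j) * ?v k)"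
    by (subst L, subst cL) (simp only: sum.distrib[symmetric] of_real_add distrib_left distrib_right)
  also have "\<dots> = (\<Sum>k<n. \<Sum>j<n. if j = k then - (cnj (?v k) * ?v k) else 0)"
    by (intro sum.cong refl) (simp add: sym)
  also have "\<dots> = - (\<Sum>k<n. cnj (?v k) * ?v k)"
    by (simp add: sum_negf)
  also have "(\<Sum>k<n. cnj (?v k) * ?v k) = (minv V * V) $$ (i, i)"
    using D(1,2) i by (subst index_mult_sum) (auto simp: D(5) index_mat_adjoint[OF D(1)])
  also have "\<dots> = 1"
    unfolding D(3) using i by simp
  finally have "complex_of_real (2 * Re (\<Lambda> $$ (i, i))) = -1"
    by (simp add: complex_add_cnj)
  then have "2 * Re (\<Lambda> $$ (i, i)) = -1"
    by (metis of_real_1 of_real_eq_iff of_real_minus)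
  then show ?thesis by simp
qed

lemma index_s_minus_diagonal_mult:
  assumes L: "\<Lambda> \<in> carrier_mat n n" "diagonal_mat \<Lambda>" and Y: "Y \<in> carrier_mat n 1" and j: "j < n"
  shows "(s_minus n s \<Lambda> * Y) $$ (j, 0) = (s - \<Lambda> $$ (j, j)) * Y $$ (j, 0)"
proof -
  have "(s_minus n s \<Lambda> * Y) $$ (j, 0) = (\<Sum>k<n. s_minus n s \<Lambda> $$ (j, k) * Y $$ (k, 0))"
    using L Y j by (subst index_mult_sum) auto
  also have "\<dots> = (\<Sum>k<n. if k = j then (s - \<Lambda> $$ (j, j)) * Y $$ (j, 0) else 0)"
    using L j by (intro sum.cong) (auto simp: diagonal_mat_def)
  also have "\<dots> = (s - \<Lambda> $$ (j, j)) * Y $$ (j, 0)"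
    using j by simp
  finally show ?thesis .
qed

lemma s_minus_perp_similar:
  assumes d: "diagonalizes_A_H_perp n V \<Lambda>"
  shows "s_minus n s \<Lambda> = minv V * s_minus n s (A_H_perpc n) * V"
  unfolding diagonalizesD(8)[OF d]
  by (rule s_minus_similar) (use diagonalizesD[OF d] in auto)

text \<open>By similarity it suffices that the product of the \<open>s - \<Lambda> $$ (i, i)\<close>
  is nonzero, which holds as the eigenvalues lie on \<open>Re = -1/2\<close>.\<close>

lemma det_s_minus_A_H_perpc:
  assumes d: "diagonalizes_A_H_perp n V \<Lambda>" and s: "0 \<le> Re s"
  shows "Determinant.det (s_minus n s (A_H_perpc n)) \<noteq> 0"
proof -
  note D = diagonalizesD[OF d]
  have sA: "s_minus n s (A_H_perpc n) \<in> carrier_mat n n" by auto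
  have "Determinant.det (s_minus n s \<Lambda>) = prod_list (diag_mat (s_minus n s \<Lambda>))"
    using D(6,7) by (intro det_lower_triangular[of n]) (auto simp: diagonal_mat_def)
  also have "\<dots> = (\<Prod>i = 0..<n. s - \<Lambda> $$ (i, i))"
    unfolding prod_list_diag_prod using D(6) by (auto intro!: prod.cong)
  finally have det: "Determinant.det (s_minus n s \<Lambda>) = (\<Prod>i = 0..<n. s - \<Lambda> $$ (i, i))" .
  have "s - \<Lambda> $$ (i, i) \<noteq> 0" if "i < n" for i
    using Re_eigenvalue[OF d that] s by (auto simp: complex_eq_iff)
  then have "(\<Prod>i = 0..<n. s - \<Lambda> $$ (i, i)) \<noteq> 0"
    by simp
  with det have "Determinant.det (s_minus n s \<Lambda>) \<noteq> 0" by simp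
  then show ?thesis
    unfolding s_minus_perp_similar[OF d]
    by (auto simp: det_mult[OF mult_carrier_mat[OF D(2) sA] D(1)] det_mult[OF D(2) sA])
qed

text \<open>Both sides are \<open>B_H\<^sup>T (s - A_H_perp)\<^sup>-\<^sup>1 B_H\<close>, the right one computed in the eigenbasis.\<close>

lemma legs_partial_fractions:
  assumes d: "diagonalizes_A_H_perp n V \<Lambda>"
  obtains a \<mu> where "\<And>j. 0 \<le> a j"
    and "\<And>s. 0 \<le> Re s \<Longrightarrow> legs_prod n s \<noteq> -1 \<Longrightarrow>
      (1 - legs_prod n s) / (1 + legs_prod n s)
        = (\<Sum>j<n. complex_of_real (a j) / (s + 1/2 - \<i> * complex_of_real (\<mu> j)))"
proof
  note D = diagonalizesD[OF d]
  let ?c = "\<lambda>j. (minv V * B_Hc n) $$ (j, 0)"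
  define a where "a j = (cmod (?c j))\<^sup>2" for j
  define \<mu> where "\<mu> j = Im (\<Lambda> $$ (j, j))" for j
  show "0 \<le> a j" for j by (simp add: a_def)
  fix s assume s: "0 \<le> Re s" and p: "legs_prod n s \<noteq> -1"
  let ?z = "legs_state_perp n s"
  \<comment> \<open>The coordinates of the solution in the eigenbasis, where the system
    decouples.\<close>
  define Y where "Y = minv V * ?z"
  have Y: "Y \<in> carrier_mat n 1" unfolding Y_def using D(2) by auto
  have z: "?z = V * Y"
    unfolding Y_def by (subst assoc_mult_mat[OF D(1,2) legs_state_perp_carrier, symmetric])
      (simp add: D(4) left_mult_one_mat[OF legs_state_perp_carrier])
  have sA: "s_minus n s (A_H_perpc n) \<in> carrier_mat n n" by auto
  have "s_minus n s \<Lambda> * Y = minv V * (s_minus n s (A_H_perpc n) * (V * Y))"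
    unfolding s_minus_perp_similar[OF d]
    by (simp add: assoc_mult_mat[OF mult_carrier_mat[OF D(2) sA] D(1) Y]
        assoc_mult_mat[OF D(2) sA mult_carrier_mat[OF D(1) Y]])
  also have "\<dots> = minv V * B_Hc n"
    unfolding z[symmetric] legs_state_perp_solves[OF s p] ..
  finally have sY: "s_minus n s \<Lambda> * Y = minv V * B_Hc n" .
  have Yj: "Y $$ (j, 0) = ?c j / (s + 1/2 - \<i> * complex_of_real (\<mu> j))" if j: "j < n" for j
  proof -
    have "\<Lambda> $$ (j, j) = - 1/2 + \<i> * complex_of_real (\<mu> j)"
      using Re_eigenvalue[OF d j] by (simp add: complex_eq_iff \<mu>_def)
    then have lam: "s - \<Lambda> $$ (j, j) = s + 1/2 - \<i> * complex_of_real (\<mu> j)"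
      by simp
    have nz: "s + 1/2 - \<i> * complex_of_real (\<mu> j) \<noteq> 0"
      using s by (auto simp: complex_eq_iff)
    have "(s + 1/2 - \<i> * complex_of_real (\<mu> j)) * Y $$ (j, 0) = ?c j"
      unfolding lam[symmetric] index_s_minus_diagonal_mult[OF D(6,7) Y j, symmetric] sY ..
    then show ?thesis
      by (metis nz nonzero_mult_div_cancel_left)
  qed
  \<comment> \<open>\<open>B_H\<close> is real and \<open>V\<close> unitary, so the row
    \<open>B_H^T V\<close> is the conjugate of the column \<open>V^-1 B_H\<close>. This is why the
    residues are squared moduli.\<close>
  have c_cnj: "cnj (?c j) = (\<Sum>i<n. B_Hc n $$ (i, 0) * V $$ (i, j))" if j: "j < n" for j
    using D(1,2) j by (subst index_mult_sum) (auto simp: D(5) index_mat_adjoint[OF D(1)] mult_ac)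
  have "(\<Sum>i<n. B_Hc n $$ (i, 0) * ?z $$ (i, 0)) = (\<Sum>i<n. B_Hc n $$ (i, 0) * (\<Sum>j<n. V $$ (i, j) * Y $$ (j, 0)))"
    unfolding z using D(1) Y by (intro sum.cong refl, subst index_mult_sum) auto
  also have "\<dots> = (\<Sum>i<n. \<Sum>j<n. B_Hc n $$ (i, 0) * V $$ (i, j) * Y $$ (j, 0))"
    by (simp add: sum_distrib_left mult_ac)
  also have "\<dots> = (\<Sum>j<n. cnj (?c j) * Y $$ (j, 0))"
    by (subst sum.swap) (simp add: c_cnj sum_distrib_right)
  also have "\<dots> = (\<Sum>j<n. complex_of_real (a j) / (s + 1/2 - \<i> * complex_of_real (\<mu> j)))"
  proof (intro sum.cong refl)
    fix j assume "j \<in> {..<n}"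
    then have "cnj (?c j) * Y $$ (j, 0) = ?c j * cnj (?c j) / (s + 1/2 - \<i> * complex_of_real (\<mu> j))"
      by (simp add: Yj)
    then show "cnj (?c j) * Y $$ (j, 0) = complex_of_real (a j) / (s + 1/2 - \<i> * complex_of_real (\<mu> j))"
      by (simp only: a_def complex_norm_square)
  qed
  finally have g: "(\<Sum>i<n. B_Hc n $$ (i, 0) * ?z $$ (i, 0))
      = (\<Sum>j<n. complex_of_real (a j) / (s + 1/2 - \<i> * complex_of_real (\<mu> j)))" .
  have "(1 - legs_prod n s) / (1 + legs_prod n s) = 2 / (1 + legs_prod n s) * ((1 - legs_prod n s) / 2)"
    by (simp only: times_divide_times_eq mult.commute[of _ 2] mult_divide_mult_cancel_left_if) simp
  also have "\<dots> = 2 / (1 + legs_prod n s) * (\<Sum>i<n. B_Hc n $$ (i, 0) * legs_state n s $$ (i, 0))"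
    unfolding B_Hc_mult_legs_state[OF s] ..
  also have "\<dots> = (\<Sum>i<n. B_Hc n $$ (i, 0) * ?z $$ (i, 0))"
    unfolding sum_distrib_left by (intro sum.cong refl) (simp add: legs_state_perp_def)
  also note g
  finally show "(1 - legs_prod n s) / (1 + legs_prod n s)
        = (\<Sum>j<n. complex_of_real (a j) / (s + 1/2 - \<i> * complex_of_real (\<mu> j)))" .
qed

section \<open>Closed forms of the two transfer functions\<close>

lemma mat_add_diff_cancel:
  fixes X Y :: "complex mat"
  shows "X \<in> carrier_mat n m \<Longrightarrow> Y \<in> carrier_mat n m \<Longrightarrow> X + Y - Y = X"
  by (intro eq_matI) auto

lemma A_DPLR_eq:
  assumes d: "diagonalizes_A_H_perp n V \<Lambda>"
  shows "A_DPLR n V \<Lambda> = minv V * A_Hc n * V"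
proof -
  note D = diagonalizesD[OF d]
  let ?U = "minv V" and ?BB = "B_Hc n * transpose_mat (B_Hc n)"
  have A: "A_Hc n \<in> carrier_mat n n" and B: "B_Hc n \<in> carrier_mat n 1"
    and BT: "transpose_mat (B_Hc n) \<in> carrier_mat 1 n" and BB: "?BB \<in> carrier_mat n n" by auto
  have "\<Lambda> = ?U * A_Hc n * V + ?U * ?BB * V"
    unfolding D(8) A_H_perpc_eq mult_add_distrib_mat[OF D(2) A BB]
    by (rule add_mult_distrib_mat) (use D(1,2) A BB in auto)
  moreover have "?U * B_Hc n * transpose_mat (B_Hc n) = ?U * ?BB"
    by (rule assoc_mult_mat[OF D(2) B BT])
  ultimately have "A_DPLR n V \<Lambda> = ?U * A_Hc n * V + ?U * ?BB * V - ?U * ?BB * V"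
    unfolding A_DPLR_def by simp
  also have "\<dots> = ?U * A_Hc n * V"
    by (rule mat_add_diff_cancel[OF mult_carrier_mat[OF mult_carrier_mat[OF D(2) A] D(1)]
          mult_carrier_mat[OF mult_carrier_mat[OF D(2) BB] D(1)]])
  finally show ?thesis .
qed

lemma unit_row_mult:
  fixes X :: "complex mat"
  assumes "X \<in> carrier_mat n 1" "i < n"
  shows "(mat_of_rows n [unit_vec n i] * X) $$ (0, 0) = X $$ (i, 0)"
proof -
  have "(mat_of_rows n [unit_vec n i] * X) $$ (0, 0) = unit_vec n i \<bullet> col X 0"
    using assms by (simp add: mat_of_rows_row)
  also have "\<dots> = X $$ (i, 0)"
    using assms by (subst scalar_prod_left_unit[of _ n]) auto
  finally show ?thesis .
qed

lemma transfer_DPLR: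
  assumes d: "diagonalizes_A_H_perp n V \<Lambda>" and s: "0 \<le> Re s" and l: "1 \<le> l" "l \<le> n"
  shows "transfer (A_DPLR n V \<Lambda>) (B_DPLR n V) (C_out n l V) D s = legs_state n s $$ (l - 1, 0) + D"
proof -
  note D = diagonalizesD[OF d]
  have "transfer (A_DPLR n V \<Lambda>) (B_DPLR n V) (C_out n l V) D s
      = (mat_of_rows n [unit_vec n (l - 1)] * legs_state n s) $$ (0, 0) + D"
    unfolding A_DPLR_eq[OF d] B_DPLR_def C_out_def
    by (rule transfer_similar[OF D(2,1,3,4) _ _ _ det_s_minus_A_Hc[OF s] legs_state_solves[OF s]]) auto
  also have "(mat_of_rows n [unit_vec n (l - 1)] * legs_state n s) $$ (0, 0) = legs_state n s $$ (l - 1, 0)"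
    using l by (intro unit_row_mult) auto
  finally show ?thesis .
qed

text \<open>The factor \<open>1/2\<close> in \<open>B_Diag\<close> cancels the \<open>2\<close> in
  \<open>legs_state_perp\<close>. At \<open>s = 0\<close> the product vanishes, so both systems
  agree there.\<close>

lemma transfer_Diag:
  assumes d: "diagonalizes_A_H_perp n V \<Lambda>" and s: "0 \<le> Re s" and p: "legs_prod n s \<noteq> -1"
    and l: "1 \<le> l" "l \<le> n"
  shows "transfer (A_Diag \<Lambda>) (B_Diag n V) (C_out n l V) D s
    = legs_state n s $$ (l - 1, 0) / (1 + legs_prod n s) + D"
proof -
  note D = diagonalizesD[OF d]
  let ?X = "(1 / 2) \<cdot>\<^sub>m legs_state_perp n s"
  have X: "?X \<in> carrier_mat n 1" by (intro smult_carrier_mat) simp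
  have sA: "s_minus n s (A_H_perpc n) \<in> carrier_mat n n" by auto
  have B: "B_Hc n \<in> carrier_mat n 1" by auto
  have eq: "s_minus n s (A_H_perpc n) * ?X = (1 / 2) \<cdot>\<^sub>m B_Hc n"
    unfolding mult_smult_distrib[OF sA legs_state_perp_carrier] legs_state_perp_solves[OF s p] ..
  have "transfer (A_Diag \<Lambda>) (B_Diag n V) (C_out n l V) D s
      = transfer (minv V * A_H_perpc n * V) (minv V * ((1 / 2) \<cdot>\<^sub>m B_Hc n))
          (mat_of_rows n [unit_vec n (l - 1)] * V) D s"
    unfolding A_Diag_def B_Diag_def C_out_def mult_smult_distrib[OF D(2) B] by (subst D(8)) (rule refl)
  also have "\<dots> = (mat_of_rows n [unit_vec n (l - 1)] * ?X) $$ (0, 0) + D"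
    by (rule transfer_similar[OF D(2,1,3,4) _ _ X det_s_minus_A_H_perpc[OF d s] eq]) auto
  also have "(mat_of_rows n [unit_vec n (l - 1)] * ?X) $$ (0, 0) = ?X $$ (l - 1, 0)"
    using l by (intro unit_row_mult X) auto
  also have "\<dots> = legs_state n s $$ (l - 1, 0) / (1 + legs_prod n s)"
    using l by (simp add: legs_state_perp_def)
  finally show ?thesis .
qed

section \<open>The weight on the imaginary axis\<close>

text \<open>If \<open>m < n\<close>, the factor with \<open>k = m\<close> vanishes; otherwise every
  factor is nonnegative.\<close>

lemma legs_prod_at_nat:
  "\<exists>r\<ge>0. legs_prod n (of_nat m) = complex_of_real r"
proof (cases "m < n")
  case True
  then have "legs_prod n (of_nat m) = 0"
    unfolding legs_prod_def by (intro prod_zero) auto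
  then show ?thesis by (intro exI[of _ 0]) auto
next
  case False
  have "legs_prod n (of_nat m) = complex_of_real (\<Prod>k<n. (real m - real k) / (real m + real k + 1))"
    by (simp add: legs_prod_def)
  moreover have "0 \<le> (\<Prod>k<n. (real m - real k) / (real m + real k + 1))"
    using False by (intro prod_nonneg) auto
  ultimately show ?thesis by blast
qed

lemma cmod_ii_shift:
  "(cmod (\<i> * complex_of_real \<omega> - of_nat k))\<^sup>2 = \<omega>\<^sup>2 + (real k)\<^sup>2"
  "(cmod (\<i> * complex_of_real \<omega> + of_nat k + 1))\<^sup>2 = \<omega>\<^sup>2 + (real (Suc k))\<^sup>2"
  by (simp_all add: cmod_power2 add_ac)

text \<open>The squared numerator of each factor cancels the squared denominator of the previous
  one. The index \<open>Suc n\<close> excludes the empty product, which is 1 even at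
  \<open>\<omega> = 0\<close>, where the quotient would be \<open>0 / 0 = 0\<close>.\<close>

lemma cmod_legs_prod:
  "(cmod (legs_prod (Suc n) (\<i> * complex_of_real \<omega>)))\<^sup>2 = \<omega>\<^sup>2 / (\<omega>\<^sup>2 + (real (Suc n))\<^sup>2)"
proof (induction n)
  case 0
  show ?case
    unfolding legs_prod_Suc norm_mult norm_divide power_mult_distrib power_divide cmod_ii_shift by simp
next
  case (Suc n)
  have "(cmod (legs_prod (Suc (Suc n)) (\<i> * complex_of_real \<omega>)))\<^sup>2
      = \<omega>\<^sup>2 / (\<omega>\<^sup>2 + (real (Suc n))\<^sup>2) * ((\<omega>\<^sup>2 + (real (Suc n))\<^sup>2) / (\<omega>\<^sup>2 + (real (Suc (Suc n)))\<^sup>2))"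
    unfolding legs_prod_Suc[of "Suc n"] norm_mult norm_divide power_mult_distrib power_divide Suc.IH
      cmod_ii_shift ..
  moreover have "\<omega>\<^sup>2 + (real (Suc n))\<^sup>2 \<noteq> 0"
    by (simp add: sum_power2_eq_zero_iff del: of_nat_Suc)
  ultimately show ?case
    by (simp del: of_nat_Suc)
qed

lemma cmod_legs_prod_less_1:
  assumes n: "n \<ge> 1"
  shows "cmod (legs_prod n (\<i> * complex_of_real \<omega>)) < 1"
proof (rule power2_less_imp_less)
  have "(cmod (legs_prod n (\<i> * complex_of_real \<omega>)))\<^sup>2 = \<omega>\<^sup>2 / (\<omega>\<^sup>2 + (real n)\<^sup>2)"
    using cmod_legs_prod[of "n - 1" \<omega>] n by simp
  moreover have "0 < \<omega>\<^sup>2 + (real n)\<^sup>2"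
    using n by (intro add_nonneg_pos) auto
  ultimately show "(cmod (legs_prod n (\<i> * complex_of_real \<omega>)))\<^sup>2 < 1\<^sup>2"
    using n by (simp add: divide_less_eq)
qed simp

lemma cmod_legs_prod_le_1: "cmod (legs_prod n (\<i> * complex_of_real \<omega>)) \<le> 1"
  using cmod_legs_prod_less_1[of n \<omega>] by (cases n) auto

lemma legs_prod_noteq_minus_1: "n \<ge> 1 \<Longrightarrow> legs_prod n (\<i> * complex_of_real \<omega>) \<noteq> -1"
  using cmod_legs_prod_less_1[of n \<omega>] by auto

definition legs_weight :: "nat \<Rightarrow> real \<Rightarrow> real" where
  "legs_weight n \<omega> = Re ((1 - legs_prod n (\<i> * complex_of_real \<omega>)) / (1 + legs_prod n (\<i> * complex_of_real \<omega>)))"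

lemma borel_measurable_legs_weight [measurable]: "legs_weight n \<in> borel_measurable borel"
  unfolding legs_weight_def[abs_def] legs_prod_def by measurable

text \<open>The numerator is the real part of \<open>(1 - p) * cnj (1 + p)\<close>. At
  \<open>p = -1\<close> both sides are 0 by division by zero.\<close>

lemma Re_cayley: "Re ((1 - p) / (1 + p)) = (1 - (cmod p)\<^sup>2) / (cmod (1 + p))\<^sup>2"
  unfolding Re_divide cmod_power2 by (simp add: power2_eq_square algebra_simps)

lemma legs_weight_nonneg: "0 \<le> legs_weight n \<omega>"
  unfolding legs_weight_def Re_cayley
  using cmod_legs_prod_le_1[of n \<omega>] by (intro divide_nonneg_nonneg) (simp_all add: power_le_one)

lemma legs_weight_le_6:
  assumes n: "n \<ge> 1" and \<omega>: "\<bar>\<omega>\<bar> \<le> real n"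
  shows "legs_weight n \<omega> \<le> 6"
proof -
  define p where "p = legs_prod n (\<i> * complex_of_real \<omega>)"
  define r where "r = cmod p"
  have r2: "r\<^sup>2 = \<omega>\<^sup>2 / (\<omega>\<^sup>2 + (real n)\<^sup>2)"
    using cmod_legs_prod[of "n - 1" \<omega>] n by (simp add: r_def p_def)
  have "\<omega>\<^sup>2 \<le> (real n)\<^sup>2"
    using power_mono[OF \<omega>, of 2] by simp
  then have "r\<^sup>2 \<le> 1/2"
    using n unfolding r2 by (subst divide_le_eq) (auto simp: add_nonneg_pos)
  \<comment> \<open>\<open>25/49\<close> is the square of a rational and lies just above
    \<open>1/2\<close>.\<close>
  also have "\<dots> \<le> (5/7)\<^sup>2"
    by (simp add: power2_eq_square)
  finally have r: "0 \<le> r" "r \<le> 5/7"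
    by (auto simp: r_def dest: power2_le_imp_le)
  have "legs_weight n \<omega> = (1 - r\<^sup>2) / (cmod (1 + p))\<^sup>2"
    by (simp add: legs_weight_def Re_cayley r_def p_def)
  also have "\<dots> \<le> (1 - r\<^sup>2) / (1 - r)\<^sup>2"
  proof (rule divide_left_mono)
    have "1 - r \<le> cmod (1 + p)"
      using norm_diff_ineq[of 1 p] by (simp add: r_def)
    then show le: "(1 - r)\<^sup>2 \<le> (cmod (1 + p))\<^sup>2"
      using r by (intro power_mono) auto
    show "0 \<le> 1 - r\<^sup>2"
      using r by (simp add: power_le_one)
    have "0 < (1 - r)\<^sup>2" using r by simp
    with le show "0 < (cmod (1 + p))\<^sup>2 * (1 - r)\<^sup>2"
      by (intro mult_pos_pos) linarith+
  qed
  \<comment> \<open>The quotient is \<open>(1 + r) / (1 - r)\<close>, which equals 6 at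
    \<open>r = 5/7\<close>.\<close>
  also have "\<dots> \<le> 6"
  proof -
    have "1 - r\<^sup>2 = (1 + r) * (1 - r)"
      by (simp add: power2_eq_square algebra_simps)
    also have "\<dots> \<le> (6 * (1 - r)) * (1 - r)"
      using r by (intro mult_right_mono) auto
    finally have "1 - r\<^sup>2 \<le> 6 * (1 - r)\<^sup>2"
      by (simp only: power2_eq_square mult.assoc)
    moreover have "0 < (1 - r)\<^sup>2" using r by simp
    ultimately show ?thesis
      by (simp add: divide_le_eq)
  qed
  finally show ?thesis .
qed

text \<open>With \<open>k = l - 1\<close> the left side is \<open>(2k+1)/2\<close> times
  \<open>|p_k|^2\<close> times \<open>\<omega>^2 / (\<omega>^2 + l^2)\<close>, and the last two
  factors are at most 1.\<close>

lemma cmod_legs_state_le: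
  assumes l: "1 \<le> l" "l \<le> n"
  shows "(cmod (legs_state n (\<i> * complex_of_real \<omega>) $$ (l - 1, 0)))\<^sup>2 * \<omega>\<^sup>2 \<le> real l"
proof -
  obtain k where k: "l = Suc k"
    using l by (cases l) auto
  let ?p = "legs_prod k (\<i> * complex_of_real \<omega>)"
  have "cmod (legs_state n (\<i> * complex_of_real \<omega>) $$ (k, 0))
      = sqrt (2 * real k + 1) * (cmod ?p / (sqrt 2 * cmod (\<i> * complex_of_real \<omega> + of_nat k + 1)))"
    using l k by (simp add: legs_state_def norm_mult norm_divide)
  then have "(cmod (legs_state n (\<i> * complex_of_real \<omega>) $$ (k, 0)))\<^sup>2
      = (sqrt (2 * real k + 1))\<^sup>2 * ((cmod ?p)\<^sup>2 / ((sqrt 2)\<^sup>2 * (\<omega>\<^sup>2 + (real l)\<^sup>2)))"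
    by (simp only: power_mult_distrib power_divide cmod_ii_shift k)
  then have "(cmod (legs_state n (\<i> * complex_of_real \<omega>) $$ (k, 0)))\<^sup>2 * \<omega>\<^sup>2
      = (2 * real k + 1) / 2 * ((cmod ?p)\<^sup>2 * (\<omega>\<^sup>2 / (\<omega>\<^sup>2 + (real l)\<^sup>2)))"
    by simp
  also have "\<dots> \<le> (2 * real k + 1) / 2 * (1 * 1)"
    using l cmod_legs_prod_le_1[of k \<omega>]
    by (intro mult_left_mono mult_mono) (auto simp: power_le_one divide_le_eq_1 sum_power2_gt_zero_iff)
  also have "\<dots> \<le> real l"
    using k by simp
  finally show ?thesis using k by simp
qed

lemma transfer_diff_le:
  assumes d: "diagonalizes_A_H_perp n V \<Lambda>" and l: "1 \<le> l" "l \<le> n"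
  shows "(cmod (transfer (A_DPLR n V \<Lambda>) (B_DPLR n V) (C_out n l V) D (\<i> * complex_of_real \<omega>)
      - transfer (A_Diag \<Lambda>) (B_Diag n V) (C_out n l V) D (\<i> * complex_of_real \<omega>)))\<^sup>2
    \<le> real l / (real n)\<^sup>2 * legs_weight n \<omega>" (is "(cmod ?T)\<^sup>2 \<le> _")
proof -
  define p where "p = legs_prod n (\<i> * complex_of_real \<omega>)"
  define x where "x = legs_state n (\<i> * complex_of_real \<omega>) $$ (l - 1, 0)"
  have n: "n \<ge> 1" using l by simp
  have pm: "p \<noteq> -1"
    unfolding p_def by (rule legs_prod_noteq_minus_1[OF n])
  then have p0: "1 + p \<noteq> 0"
    by (metis add.commute add_eq_0_iff)
  have "?T = x - x / (1 + p)"
    using transfer_DPLR[OF d _ l, of "\<i> * complex_of_real \<omega>" D]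
      transfer_Diag[OF d _ _ l, of "\<i> * complex_of_real \<omega>" D] pm
    by (simp add: p_def x_def)
  also have "\<dots> = x * p / (1 + p)"
    using p0 by (simp add: field_simps)
  finally have "(cmod ?T)\<^sup>2 = (cmod x)\<^sup>2 * (cmod p)\<^sup>2 / (cmod (1 + p))\<^sup>2"
    by (simp add: norm_mult norm_divide power_mult_distrib power_divide)
  \<comment> \<open>The identity \<open>|p|^2 = (\<omega>^2 / n^2) (1 - |p|^2)\<close> produces the
    numerator of the weight; this is the source of the factor \<open>1 / n^2\<close>.\<close>
  also have "\<dots> = (cmod x)\<^sup>2 * \<omega>\<^sup>2 / (real n)\<^sup>2 * legs_weight n \<omega>"
  proof -
    have "\<omega>\<^sup>2 + (real n)\<^sup>2 \<noteq> 0" using n by (simp add: sum_power2_eq_zero_iff)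
    moreover have p2: "(cmod p)\<^sup>2 = \<omega>\<^sup>2 / (\<omega>\<^sup>2 + (real n)\<^sup>2)"
      using cmod_legs_prod[of "n - 1" \<omega>] n by (simp add: p_def)
    ultimately have "1 - (cmod p)\<^sup>2 = (real n)\<^sup>2 / (\<omega>\<^sup>2 + (real n)\<^sup>2)"
      by (simp add: field_simps)
    then show ?thesis
      using n unfolding legs_weight_def Re_cayley p_def[symmetric] p2 by simp
  qed
  also have "\<dots> \<le> real l / (real n)\<^sup>2 * legs_weight n \<omega>"
    using cmod_legs_state_le[OF l, of \<omega>]
    by (intro mult_right_mono divide_right_mono legs_weight_nonneg) (auto simp: x_def)
  finally show ?thesis .
qed

section \<open>Integrals of the weight over bounded intervals\<close>

text \<open>Both kernels are real parts of \<open>1 / (s + 1/2 - \<i> \<mu>)\<close>, on the left at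
  \<open>s = \<i> \<omega>\<close>, on the right at \<open>s = W\<close>. A pole of height at most
  \<open>2 W\<close> contributes no more than the full mass \<open>pi\<close> of its kernel; a
  higher one keeps a distance of at least \<open>|\<mu>| / 2\<close> from the interval.\<close>

lemma nn_integral_cauchy_kernel_le:
  fixes \<mu> W :: real
  assumes W: "1 \<le> W"
  shows "(\<integral>\<^sup>+\<omega>\<in>{-W..W}. ennreal ((1/2) / (1/4 + (\<omega> - \<mu>)\<^sup>2)) \<partial>lborel)
    \<le> ennreal (25 * W * ((W + 1/2) / ((W + 1/2)\<^sup>2 + \<mu>\<^sup>2)))"
proof -
  have W2: "(W + 1/2)\<^sup>2 \<le> (3/2 * W)\<^sup>2"
    using W by (intro power_mono) auto
  have den: "0 < (W + 1/2)\<^sup>2 + \<mu>\<^sup>2"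
    using W by (intro add_pos_nonneg) auto
  have WW: "W * W \<le> W * (W + 1/2)"
    using W by (intro mult_left_mono) auto
  show ?thesis
  proof (cases "\<bar>\<mu>\<bar> \<le> 2 * W")
    case True
    then have mu2: "\<mu>\<^sup>2 \<le> (2 * W)\<^sup>2"
      using power_mono[OF True, of 2] by simp
    have "(\<integral>\<^sup>+\<omega>\<in>{-W..W}. ennreal ((1/2) / (1/4 + (\<omega> - \<mu>)\<^sup>2)) \<partial>lborel)
        = ennreal (arctan (2 * (W - \<mu>)) - arctan (2 * (- W - \<mu>)))"
    proof (rule nn_integral_FTC_Icc)
      fix \<omega> :: real
      have "1/4 + x\<^sup>2 = (1 + (2 * x)\<^sup>2) / 4" for x :: real
        by (simp add: power_mult_distrib)
      then have "(1/2) / (1/4 + x\<^sup>2) = 2 / (1 + (2 * x)\<^sup>2)" for x :: real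
        by (simp only:) simp
      note eq = this[of "\<omega> - \<mu>"]
      have "((\<lambda>\<omega>. arctan (2 * (\<omega> - \<mu>))) has_real_derivative 2 / (1 + (2 * (\<omega> - \<mu>))\<^sup>2)) (at \<omega>)"
        by (auto intro!: derivative_eq_intros simp: field_simps)
      then show "((\<lambda>\<omega>. arctan (2 * (\<omega> - \<mu>))) has_real_derivative (1/2) / (1/4 + (\<omega> - \<mu>)\<^sup>2)) (at \<omega>)"
        by (simp only: eq)
      show "0 \<le> (1/2) / (1/4 + (\<omega> - \<mu>)\<^sup>2)"
        by simp
    qed (use W in auto)
    also have "arctan (2 * (W - \<mu>)) - arctan (2 * (- W - \<mu>)) \<le> 4"
      using arctan_bounded[of "2 * (W - \<mu>)"] arctan_bounded[of "2 * (- W - \<mu>)"] pi_less_4 by linarith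
    \<comment> \<open>The constant 25 arises as \<open>4 ((3/2)^2 + 2^2)\<close>, from
      \<open>W + 1/2 \<le> 3/2 W\<close> and \<open>|\<mu>| \<le> 2 W\<close>.\<close>
    also have "4 \<le> 25 * W * ((W + 1/2) / ((W + 1/2)\<^sup>2 + \<mu>\<^sup>2))"
    proof -
      have "4 * ((W + 1/2)\<^sup>2 + \<mu>\<^sup>2) \<le> 25 * (W * (W + 1/2))"
        using W2 mu2 WW by (simp add: power2_eq_square)
      then show ?thesis
        using den by (simp add: le_divide_eq mult.assoc)
    qed
    finally show ?thesis by (simp add: ennreal_leI)
  next
    case False
    then have mu: "2 * W < \<bar>\<mu>\<bar>" by simp
    then have mu2: "(2 * W)\<^sup>2 \<le> \<mu>\<^sup>2"
      using power_mono[of "2 * W" "\<bar>\<mu>\<bar>" 2] W by simp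
    have mu0: "0 < \<mu>\<^sup>2" using mu W by auto
    have "(\<integral>\<^sup>+\<omega>\<in>{-W..W}. ennreal ((1/2) / (1/4 + (\<omega> - \<mu>)\<^sup>2)) \<partial>lborel)
        \<le> (\<integral>\<^sup>+\<omega>. ennreal (2 / \<mu>\<^sup>2) * indicator {-W..W} \<omega> \<partial>lborel)"
    proof (intro nn_integral_mono)
      fix \<omega>
      show "ennreal ((1/2) / (1/4 + (\<omega> - \<mu>)\<^sup>2)) * indicator {-W..W} \<omega>
        \<le> ennreal (2 / \<mu>\<^sup>2) * indicator {-W..W} \<omega>"
      proof (cases "\<omega> \<in> {-W..W}")
        case True
        then have "\<bar>\<mu>\<bar> / 2 \<le> \<bar>\<omega> - \<mu>\<bar>"
          using mu by (auto simp: abs_if split: if_splits)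
        from power_mono[OF this, of 2] have "\<mu>\<^sup>2 / 4 \<le> (\<omega> - \<mu>)\<^sup>2"
          by (simp add: power_divide)
        then have "\<mu>\<^sup>2 / 4 \<le> 1/4 + (\<omega> - \<mu>)\<^sup>2" by simp
        then have "(1/2) / (1/4 + (\<omega> - \<mu>)\<^sup>2) \<le> (1/2) / (\<mu>\<^sup>2 / 4)"
          using mu0 by (intro divide_left_mono mult_pos_pos) (auto intro: add_pos_nonneg)
        then show ?thesis
          using True by (auto intro!: ennreal_leI)
      qed simp
    qed
    also have "\<dots> = ennreal (2 / \<mu>\<^sup>2 * (2 * W))"
    proof -
      have "(\<integral>\<^sup>+\<omega>. indicator {-W..W} \<omega> \<partial>lborel) = ennreal (2 * W)"
        using W by simp
      then show ?thesis
        using W by (subst nn_integral_cmult) (simp_all only: ennreal_mult[symmetric], auto simp: ennreal_mult[symmetric])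
    qed
    \<comment> \<open>Here \<open>W + 1/2 \<le> 3/2 W < 3/4 |\<mu>|\<close>, and
      \<open>9/16 + 1\<close> gives the factor \<open>25/16\<close>.\<close>
    also have "2 / \<mu>\<^sup>2 * (2 * W) \<le> 25 * W * ((W + 1/2) / ((W + 1/2)\<^sup>2 + \<mu>\<^sup>2))"
    proof -
      have "(W + 1/2)\<^sup>2 + \<mu>\<^sup>2 \<le> 25/16 * \<mu>\<^sup>2"
        using W2 mu2 by (simp add: power2_eq_square)
      also have "4 * (25/16 * \<mu>\<^sup>2) \<le> 25 * (W + 1/2) * \<mu>\<^sup>2"
        using W mult_right_mono[of "25/4" "25 * (W + 1/2)" "\<mu>\<^sup>2"] by simp
      finally have "4 * ((W + 1/2)\<^sup>2 + \<mu>\<^sup>2) \<le> 25 * (W + 1/2) * \<mu>\<^sup>2" by simp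
      then have "4 / \<mu>\<^sup>2 \<le> 25 * (W + 1/2) / ((W + 1/2)\<^sup>2 + \<mu>\<^sup>2)"
        using den mu0 by (simp add: field_simps)
      then have "W * (4 / \<mu>\<^sup>2) \<le> W * (25 * (W + 1/2) / ((W + 1/2)\<^sup>2 + \<mu>\<^sup>2))"
        using W by (intro mult_left_mono) auto
      then show ?thesis by (simp add: mult_ac)
    qed
    finally show ?thesis by (simp add: ennreal_leI)
  qed
qed

text \<open>\<open>(1 - p) / (1 + p)\<close> has positive real part on the right half-plane, and its value at a positive
  integer, where \<open>p \<ge> 0\<close>, is a Poisson average of its boundary values.\<close>

lemma nn_integral_legs_weight_le:
  assumes d: "diagonalizes_A_H_perp n V \<Lambda>" and n: "n \<ge> 1" and m: "m \<ge> 1"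
  shows "(\<integral>\<^sup>+\<omega>\<in>{- real m..real m}. ennreal (legs_weight n \<omega>) \<partial>lborel) \<le> ennreal (25 * real m)"
proof -
  obtain a \<mu> where a: "\<And>j. 0 \<le> a j"
    and pf: "\<And>s. 0 \<le> Re s \<Longrightarrow> legs_prod n s \<noteq> -1 \<Longrightarrow>
      (1 - legs_prod n s) / (1 + legs_prod n s)
        = (\<Sum>j<n. complex_of_real (a j) / (s + 1/2 - \<i> * complex_of_real (\<mu> j)))"
    using legs_partial_fractions[OF d] by blast
  \<comment> \<open>The residues are real and the poles lie on \<open>Re s = -1/2\<close>, so each
    fraction contributes a Poisson kernel of width \<open>1/2\<close>.\<close>
  have weight: "legs_weight n \<omega> = (\<Sum>j<n. a j * ((1/2) / (1/4 + (\<omega> - \<mu> j)\<^sup>2)))" for \<omega>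
    unfolding legs_weight_def
    by (subst pf) (auto simp: legs_prod_noteq_minus_1[OF n] Re_divide power2_eq_square intro!: sum.cong)
  let ?P = "\<lambda>j. (real m + 1/2) / ((real m + 1/2)\<^sup>2 + (\<mu> j)\<^sup>2)"
  \<comment> \<open>At \<open>s = m\<close> the same fractions sum to
    \<open>g(m) = (1 - r) / (1 + r)\<close>, which is at most 1 because
    \<open>r \<ge> 0\<close>.\<close>
  obtain r where r: "r \<ge> 0" "legs_prod n (of_nat m) = complex_of_real r"
    using legs_prod_at_nat by blast
  have "legs_prod n (of_nat m) \<noteq> -1"
    using r by (simp add: complex_eq_iff)
  then have "Re ((1 - complex_of_real r) / (1 + complex_of_real r)) = (\<Sum>j<n. a j * ?P j)"
    unfolding r(2)[symmetric]
    by (subst pf) (auto simp: Re_divide power2_eq_square intro!: sum.cong)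
  moreover have "(1 - complex_of_real r) / (1 + complex_of_real r) = complex_of_real ((1 - r) / (1 + r))"
    by simp
  ultimately have "(\<Sum>j<n. a j * ?P j) = (1 - r) / (1 + r)"
    by (simp only: Re_complex_of_real)
  also have "\<dots> \<le> 1" using r by simp
  finally have sum_le: "(\<Sum>j<n. a j * ?P j) \<le> 1" .
  have "(\<integral>\<^sup>+\<omega>\<in>{- real m..real m}. ennreal (legs_weight n \<omega>) \<partial>lborel)
      = (\<integral>\<^sup>+\<omega>. (\<Sum>j<n. ennreal (a j) * (ennreal ((1/2) / (1/4 + (\<omega> - \<mu> j)\<^sup>2)) * indicator {- real m..real m} \<omega>)) \<partial>lborel)"
    unfolding weight
    by (intro nn_integral_cong, subst sum_ennreal[symmetric])
      (auto simp: a sum_distrib_right ennreal_mult[symmetric] indicator_def)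
  also have "\<dots> = (\<Sum>j<n. ennreal (a j) * (\<integral>\<^sup>+\<omega>\<in>{- real m..real m}. ennreal ((1/2) / (1/4 + (\<omega> - \<mu> j)\<^sup>2)) \<partial>lborel))"
    by (subst nn_integral_sum) (auto simp: nn_integral_cmult)
  also have "\<dots> \<le> (\<Sum>j<n. ennreal (a j) * ennreal (25 * real m * ?P j))"
    using m by (intro sum_mono mult_left_mono nn_integral_cauchy_kernel_le) auto
  also have "\<dots> = ennreal (25 * real m * (\<Sum>j<n. a j * ?P j))"
    by (simp add: a ennreal_mult[symmetric] sum_ennreal sum_distrib_left mult_ac)
  also have "\<dots> \<le> ennreal (25 * real m)"
    using sum_le by (intro ennreal_leI) (simp add: mult_left_le)
  finally show ?thesis .
qed

section \<open>Dyadic summation against the decay of the input\<close>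

lemma obtain_dyadic:
  fixes x :: real
  assumes "1 \<le> x"
  obtains k where "2 ^ k \<le> x" "x < 2 ^ Suc k"
proof -
  define m where "m = (LEAST m. x < 2 ^ m)"
  have ex: "\<exists>m. x < 2 ^ m"
    by (rule real_arch_pow) simp
  have m: "x < 2 ^ m"
    unfolding m_def by (rule LeastI_ex[OF ex])
  with assms obtain k where k: "m = Suc k"
    by (cases m) auto
  then have "\<not> x < 2 ^ k"
    using not_less_Least[of k "\<lambda>m. x < 2 ^ m"] by (simp add: m_def)
  with m k show ?thesis
    by (intro that[of k]) auto
qed

text \<open>On the shell \<open>2^k \<le> |\<omega>| < 2^(k+1)\<close> the power is at most
  \<open>2^(-2qk)\<close>, and the weight has integral at most \<open>25 * 2^(k+1)\<close> over the
  enclosing interval. The resulting geometric series has first term 50 and ratio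
  \<open>2 powr (1 - 2 * q) < 1\<close>.\<close>

lemma nn_integral_legs_weight_powr_le:
  assumes d: "diagonalizes_A_H_perp n V \<Lambda>" and n: "n \<ge> 1" and q: "q > 1/2"
  shows "(\<integral>\<^sup>+\<omega>\<in>{\<omega>. 1 \<le> \<bar>\<omega>\<bar>}. ennreal (legs_weight n \<omega> * \<bar>\<omega>\<bar> powr (- 2 * q)) \<partial>lborel)
    \<le> ennreal (50 / (1 - 2 powr (1 - 2 * q)))"
proof -
  define r where "r = 2 powr (1 - 2 * q)"
  have r: "0 < r" "r < 1"
    using q by (auto simp: r_def powr_less_one)
  let ?t = "\<lambda>k::nat. 2 powr (- 2 * q * real k)"
  let ?I = "\<lambda>k \<omega>. indicator {- real (2 ^ Suc k)..real (2 ^ Suc k)} \<omega> :: ennreal"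
  \<comment> \<open>The single term of the shell containing \<open>\<omega>\<close> already
    dominates; all others are nonnegative.\<close>
  have pointwise: "ennreal (legs_weight n \<omega> * \<bar>\<omega>\<bar> powr (- 2 * q)) * indicator {\<omega>. 1 \<le> \<bar>\<omega>\<bar>} \<omega>
      \<le> (\<Sum>k. ennreal (?t k) * (ennreal (legs_weight n \<omega>) * ?I k \<omega>))" for \<omega>
  proof (cases "1 \<le> \<bar>\<omega>\<bar>")
    case True
    then obtain k where k: "2 ^ k \<le> \<bar>\<omega>\<bar>" "\<bar>\<omega>\<bar> < 2 ^ Suc k"
      by (rule obtain_dyadic)
    have "\<bar>\<omega>\<bar> powr (- 2 * q) \<le> (2 ^ k) powr (- 2 * q)"
      using k q by (intro powr_mono2') auto
    also have "(2 ^ k) powr (- 2 * q) = ?t k"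
      by (simp add: powr_realpow[symmetric] powr_powr mult_ac)
    finally have "legs_weight n \<omega> * \<bar>\<omega>\<bar> powr (- 2 * q) \<le> legs_weight n \<omega> * ?t k"
      by (intro mult_left_mono legs_weight_nonneg)
    then have "ennreal (legs_weight n \<omega> * \<bar>\<omega>\<bar> powr (- 2 * q)) \<le> ennreal (?t k * legs_weight n \<omega>)"
      by (intro ennreal_leI) (simp only: mult.commute[of "?t k"])
    also have "\<dots> = ennreal (?t k) * ennreal (legs_weight n \<omega>)"
      by (rule ennreal_mult) (auto simp: legs_weight_nonneg)
    finally have "ennreal (legs_weight n \<omega> * \<bar>\<omega>\<bar> powr (- 2 * q)) \<le> ennreal (?t k) * ennreal (legs_weight n \<omega>)" .
    moreover have "?I k \<omega> = 1"
      using k by (auto simp: indicator_def abs_le_iff)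
    ultimately have "ennreal (legs_weight n \<omega> * \<bar>\<omega>\<bar> powr (- 2 * q)) * indicator {\<omega>. 1 \<le> \<bar>\<omega>\<bar>} \<omega>
        \<le> ennreal (?t k) * (ennreal (legs_weight n \<omega>) * ?I k \<omega>)"
      using True by simp
    also have "\<dots> = (\<Sum>k\<in>{k}. ennreal (?t k) * (ennreal (legs_weight n \<omega>) * ?I k \<omega>))"
      by simp
    also have "\<dots> \<le> (\<Sum>k. ennreal (?t k) * (ennreal (legs_weight n \<omega>) * ?I k \<omega>))"
      by (intro sum_le_suminf summableI) auto
    finally show ?thesis .
  qed simp
  have "(\<integral>\<^sup>+\<omega>\<in>{\<omega>. 1 \<le> \<bar>\<omega>\<bar>}. ennreal (legs_weight n \<omega> * \<bar>\<omega>\<bar> powr (- 2 * q)) \<partial>lborel)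
      \<le> (\<integral>\<^sup>+\<omega>. (\<Sum>k. ennreal (?t k) * (ennreal (legs_weight n \<omega>) * ?I k \<omega>)) \<partial>lborel)"
    by (intro nn_integral_mono pointwise)
  also have "\<dots> = (\<Sum>k. ennreal (?t k) * (\<integral>\<^sup>+\<omega>. ennreal (legs_weight n \<omega>) * ?I k \<omega> \<partial>lborel))"
    by (subst nn_integral_suminf) (auto simp: nn_integral_cmult)
  also have "\<dots> \<le> (\<Sum>k. ennreal (?t k) * ennreal (25 * real (2 ^ Suc k)))"
    by (intro suminf_le mult_left_mono nn_integral_legs_weight_le[OF d n] summableI one_le_power) auto
  also have "\<dots> = (\<Sum>k. ennreal (50 * r ^ k))"
  proof (intro suminf_cong)
    fix k
    have "?t k * (25 * real (2 ^ Suc k)) = 50 * (?t k * 2 powr real k)"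
      by (simp add: powr_realpow)
    also have "?t k * 2 powr real k = r ^ k"
      by (simp add: r_def powr_realpow[symmetric] powr_powr powr_add[symmetric] algebra_simps)
    finally have eq: "?t k * (25 * real (2 ^ Suc k)) = 50 * r ^ k" .
    have "ennreal (?t k) * ennreal (25 * real (2 ^ Suc k)) = ennreal (?t k * (25 * real (2 ^ Suc k)))"
      by (rule ennreal_mult[symmetric]) auto
    then show "ennreal (?t k) * ennreal (25 * real (2 ^ Suc k)) = ennreal (50 * r ^ k)"
      unfolding eq .
  qed
  also have "\<dots> = ennreal (50 / (1 - r))"
  proof (rule suminf_ennreal_eq)
    show "(\<lambda>k. 50 * r ^ k) sums (50 / (1 - r))"
      using sums_mult[OF geometric_sums[of r], of 50] r by simp
  qed (use r in auto)
  finally show ?thesis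
    by (simp add: r_def)
qed

text \<open>Powers of \<open>|s|\<close> are monotone in the exponent once the threshold is raised
  to at least 1. This lets one exponent \<open>q'\<close> serve all \<open>q \<ge> q'\<close>, which
  is how the constant becomes uniform.\<close>

lemma fourier_decay_mono:
  assumes "q' \<le> q" "0 \<le> M" "fourier_decay q M u"
  shows "fourier_decay q' M u"
proof -
  from assms(3) obtain uhat S where u: "fourier_L2 u uhat"
    and ae: "AE s in lborel. S \<le> \<bar>s\<bar> \<longrightarrow> cmod (uhat s) \<le> M * \<bar>s\<bar> powr (- q)"
    unfolding fourier_decay_def by blast
  have "AE s in lborel. max S 1 \<le> \<bar>s\<bar> \<longrightarrow> cmod (uhat s) \<le> M * \<bar>s\<bar> powr (- q')"
    using ae
  proof eventually_elim
    case (elim s)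
    show ?case
    proof
      assume s: "max S 1 \<le> \<bar>s\<bar>"
      then have "cmod (uhat s) \<le> M * \<bar>s\<bar> powr (- q)" using elim by simp
      also have "\<dots> \<le> M * \<bar>s\<bar> powr (- q')"
        using s assms by (intro mult_left_mono powr_mono) auto
      finally show "cmod (uhat s) \<le> M * \<bar>s\<bar> powr (- q')" .
    qed
  qed
  with u show ?thesis
    unfolding fourier_decay_def by blast
qed

text \<open>The line is split at \<open>|s| = n\<close>: inside, the weight is at most 6; outside,
  \<open>S \<le> n\<close> makes the decay available and the dyadic bound applies.\<close>

lemma nn_integral_legs_weight_uhat_le:
  assumes d: "diagonalizes_A_H_perp n V \<Lambda>" and n: "n \<ge> 1" and q: "q > 1/2" and S: "S \<le> real n"
    and uhat: "uhat \<in> L2"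
    and decay: "AE s in lborel. S \<le> \<bar>s\<bar> \<longrightarrow> cmod (uhat s) \<le> M * \<bar>s\<bar> powr (- q)"
  shows "(\<integral>\<^sup>+s. ennreal (legs_weight n s * (cmod (uhat s))\<^sup>2) \<partial>lborel)
    \<le> ennreal (6 * (L2_norm uhat)\<^sup>2 + M\<^sup>2 * (50 / (1 - 2 powr (1 - 2 * q))))"
proof -
  let ?T = "\<lambda>s. ennreal (legs_weight n s * \<bar>s\<bar> powr (- 2 * q)) * indicator {s. 1 \<le> \<bar>s\<bar>} s"
  have r: "0 < 1 - 2 powr (1 - 2 * q)"
    using q by (simp add: powr_less_one)
  have [measurable]: "uhat \<in> borel_measurable borel"
    using uhat by measurable
  have "AE s in lborel. ennreal (legs_weight n s * (cmod (uhat s))\<^sup>2)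
      \<le> ennreal 6 * ennreal ((cmod (uhat s))\<^sup>2) + ennreal (M\<^sup>2) * ?T s"
    using decay
  proof eventually_elim
    case (elim s)
    show ?case
    proof (cases "\<bar>s\<bar> \<le> real n")
      case True
      have "legs_weight n s * (cmod (uhat s))\<^sup>2 \<le> 6 * (cmod (uhat s))\<^sup>2"
        by (intro mult_right_mono legs_weight_le_6[OF n True]) simp
      then have "ennreal (legs_weight n s * (cmod (uhat s))\<^sup>2) \<le> ennreal 6 * ennreal ((cmod (uhat s))\<^sup>2)"
        by (subst ennreal_mult[symmetric]) (auto intro: ennreal_leI)
      then show ?thesis
        by (rule order_trans) simp
    next
      case False
      then have s: "1 \<le> \<bar>s\<bar>" "S \<le> \<bar>s\<bar>" using n S by auto
      then have "(cmod (uhat s))\<^sup>2 \<le> (M * \<bar>s\<bar> powr (- q))\<^sup>2"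
        using elim by (intro power_mono) auto
      also have "\<dots> = M\<^sup>2 * \<bar>s\<bar> powr (- 2 * q)"
        using s by (simp add: power_mult_distrib power2_eq_square powr_add[symmetric])
      finally have "legs_weight n s * (cmod (uhat s))\<^sup>2 \<le> legs_weight n s * (M\<^sup>2 * \<bar>s\<bar> powr (- 2 * q))"
        by (intro mult_left_mono legs_weight_nonneg)
      then have "ennreal (legs_weight n s * (cmod (uhat s))\<^sup>2)
          \<le> ennreal (M\<^sup>2 * (legs_weight n s * \<bar>s\<bar> powr (- 2 * q)))"
        by (intro ennreal_leI) (simp add: mult_ac)
      also have "\<dots> = ennreal (M\<^sup>2) * ?T s"
        using s by (simp add: ennreal_mult' legs_weight_nonneg)
      finally show ?thesis
        by (rule order_trans) simp
    qed
  qed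
  then have "(\<integral>\<^sup>+s. ennreal (legs_weight n s * (cmod (uhat s))\<^sup>2) \<partial>lborel)
      \<le> (\<integral>\<^sup>+s. ennreal 6 * ennreal ((cmod (uhat s))\<^sup>2) + ennreal (M\<^sup>2) * ?T s \<partial>lborel)"
    by (rule nn_integral_mono_AE)
  also have "\<dots> = ennreal 6 * (\<integral>\<^sup>+s. ennreal ((cmod (uhat s))\<^sup>2) \<partial>lborel)
      + ennreal (M\<^sup>2) * (\<integral>\<^sup>+s. ?T s \<partial>lborel)"
    by (subst nn_integral_add) (auto simp: nn_integral_cmult)
  also have "\<dots> \<le> ennreal 6 * ennreal ((L2_norm uhat)\<^sup>2)
      + ennreal (M\<^sup>2) * ennreal (50 / (1 - 2 powr (1 - 2 * q)))"
    using nn_integral_legs_weight_powr_le[OF d n q]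
    by (intro add_mono mult_left_mono)
      (auto simp: L2_norm_square nn_integral_eq_integral[OF L2_integrable[OF uhat]])
  also have "\<dots> = ennreal (6 * (L2_norm uhat)\<^sup>2 + M\<^sup>2 * (50 / (1 - 2 powr (1 - 2 * q))))"
  proof -
    have "ennreal 6 * ennreal ((L2_norm uhat)\<^sup>2) = ennreal (6 * (L2_norm uhat)\<^sup>2)"
      "ennreal (M\<^sup>2) * ennreal (50 / (1 - 2 powr (1 - 2 * q)))
        = ennreal (M\<^sup>2 * (50 / (1 - 2 powr (1 - 2 * q))))"
      by (intro ennreal_mult[symmetric] zero_le_power2 divide_nonneg_nonneg less_imp_le[OF r]; simp)+
    then show ?thesis
      using r by (simp only:, subst ennreal_plus[symmetric]) auto
  qed
  finally show ?thesis .
qed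

section \<open>From the frequency side back to the outputs\<close>

lemma output_diff_bound:
  assumes q: "q > 1/2" and l: "1 \<le> l" "l \<le> n" and S: "S \<le> real n"
    and d: "diagonalizes_A_H_perp n V \<Lambda>"
    and u: "fourier_L2 u uhat" "L2_norm u = 1"
    and decay: "AE s in lborel. S \<le> \<bar>s\<bar> \<longrightarrow> cmod (uhat s) \<le> M * \<bar>s\<bar> powr (- q)"
    and y1: "system_output (A_DPLR n V \<Lambda>) (B_DPLR n V) (C_out n l V) D u y1"
    and y2: "system_output (A_Diag \<Lambda>) (B_Diag n V) (C_out n l V) D u y2"
  shows "L2_norm (\<lambda>t. y1 t - y2 t)
    \<le> sqrt (6 + 50 * M\<^sup>2 / (1 - 2 powr (1 - 2 * q))) * sqrt (real l) / real n"
proof -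
  let ?T1 = "\<lambda>s. transfer (A_DPLR n V \<Lambda>) (B_DPLR n V) (C_out n l V) D (\<i> * complex_of_real s)"
  let ?T2 = "\<lambda>s. transfer (A_Diag \<Lambda>) (B_Diag n V) (C_out n l V) D (\<i> * complex_of_real s)"
  let ?R = "50 * M\<^sup>2 / (1 - 2 powr (1 - 2 * q))"
  have n: "n \<ge> 1" using l by simp
  have R: "0 \<le> ?R"
    using q by (simp add: powr_less_one less_imp_le)
  \<comment> \<open>Each output relation brings its own representative of the transform of
    \<open>u\<close>; both agree with \<open>uhat\<close> almost everywhere.\<close>
  obtain v w where v: "fourier_L2 u v" "fourier_L2 y1 (\<lambda>s. ?T1 s * v s)"
    and w: "fourier_L2 u w" "fourier_L2 y2 (\<lambda>s. ?T2 s * w s)"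
    using y1 y2 unfolding system_output_def by blast
  note diff = fourier_L2_diff[OF v(2) w(2)]
  let ?g = "\<lambda>s. ?T1 s * v s - ?T2 s * w s"
  have g: "?g \<in> L2" using diff by (simp add: fourier_L2_def)
  have uhat: "uhat \<in> L2" using u(1) by (simp add: fourier_L2_def)
  have norm_uhat: "(L2_norm uhat)\<^sup>2 = 2 * pi"
    using L2_norm_fourier_L2[OF u(1)] u(2) by simp
  have "AE s in lborel. ennreal ((cmod (?g s))\<^sup>2)
      \<le> ennreal (real l / (real n)\<^sup>2) * ennreal (legs_weight n s * (cmod (uhat s))\<^sup>2)"
    using fourier_L2_unique[OF v(1) u(1)] fourier_L2_unique[OF w(1) u(1)]
  proof eventually_elim
    case (elim s)
    then have "(cmod (?g s))\<^sup>2 = (cmod (?T1 s - ?T2 s))\<^sup>2 * (cmod (uhat s))\<^sup>2"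
      by (simp add: left_diff_distrib[symmetric] norm_mult power_mult_distrib)
    also have "\<dots> \<le> real l / (real n)\<^sup>2 * legs_weight n s * (cmod (uhat s))\<^sup>2"
      by (intro mult_right_mono transfer_diff_le[OF d l]) simp
    finally show ?case
      by (subst ennreal_mult[symmetric]) (auto simp: legs_weight_nonneg mult.assoc intro: ennreal_leI)
  qed
  then have "(\<integral>\<^sup>+s. ennreal ((cmod (?g s))\<^sup>2) \<partial>lborel)
      \<le> (\<integral>\<^sup>+s. ennreal (real l / (real n)\<^sup>2) * ennreal (legs_weight n s * (cmod (uhat s))\<^sup>2) \<partial>lborel)"
    by (rule nn_integral_mono_AE)
  also have "\<dots> = ennreal (real l / (real n)\<^sup>2) * (\<integral>\<^sup>+s. ennreal (legs_weight n s * (cmod (uhat s))\<^sup>2) \<partial>lborel)"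
    using L2_measurable[OF uhat] by (intro nn_integral_cmult) measurable
  also have "\<dots> \<le> ennreal (real l / (real n)\<^sup>2) * ennreal (6 * (L2_norm uhat)\<^sup>2 + M\<^sup>2 * (50 / (1 - 2 powr (1 - 2 * q))))"
    by (intro mult_left_mono nn_integral_legs_weight_uhat_le[OF d n q S uhat decay]) simp
  also have "\<dots> = ennreal (real l / (real n)\<^sup>2 * (6 * (2 * pi) + ?R))"
    using R by (subst ennreal_mult[symmetric]) (auto simp: norm_uhat mult_ac)
  finally have "(L2_norm ?g)\<^sup>2 \<le> real l / (real n)\<^sup>2 * (6 * (2 * pi) + ?R)"
    using R by (simp add: L2_norm_square nn_integral_eq_integral[OF L2_integrable[OF g]])
  \<comment> \<open>As \<open>2 * pi \<ge> 1\<close>, this factor may be put in front of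
    \<open>?R\<close> as well; it then cancels the Plancherel factor of the output norm.\<close>
  also have "\<dots> \<le> real l / (real n)\<^sup>2 * (2 * pi * (6 + ?R))"
  proof (intro mult_left_mono)
    have "1 * ?R \<le> 2 * pi * ?R"
      using R pi_gt3 by (intro mult_right_mono) auto
    then show "6 * (2 * pi) + ?R \<le> 2 * pi * (6 + ?R)"
      by (simp add: algebra_simps)
  qed simp
  also have "(L2_norm ?g)\<^sup>2 = 2 * pi * (L2_norm (\<lambda>t. y1 t - y2 t))\<^sup>2"
    unfolding L2_norm_fourier_L2[OF diff] by (simp add: power_mult_distrib)
  finally have "2 * pi * (L2_norm (\<lambda>t. y1 t - y2 t))\<^sup>2 \<le> 2 * pi * ((6 + ?R) * real l / (real n)\<^sup>2)"
    by (simp add: mult_ac)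
  then have "(L2_norm (\<lambda>t. y1 t - y2 t))\<^sup>2 \<le> (6 + ?R) * real l / (real n)\<^sup>2"
    by (rule mult_left_le_imp_le) simp
  also have "\<dots> = (sqrt (6 + ?R) * sqrt (real l) / real n)\<^sup>2"
    using R by (simp add: power_mult_distrib power_divide)
  finally show ?thesis
    using R by (intro power2_le_imp_le[OF _ divide_nonneg_nonneg]) auto
qed

text \<open>The input enters only through the threshold on \<open>n\<close>, by way of
  \<open>S\<close>; the constant is determined by \<open>q'\<close> and \<open>M\<close>.\<close>

lemma eventually_output_diff_bound:
  assumes q': "q' > 1/2" and q: "q' \<le> q" and M: "M > 0" and l: "1 \<le> l"
    and u: "L2_norm u = 1" "fourier_decay q M u"
    and d: "\<And>n. l \<le> n \<Longrightarrow> diagonalizes_A_H_perp n (V n) (\<Lambda> n)"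
    and y1: "\<And>n. l \<le> n \<Longrightarrow>
      system_output (A_DPLR n (V n) (\<Lambda> n)) (B_DPLR n (V n)) (C_out n l (V n)) (D n) u (y1 n)"
    and y2: "\<And>n. l \<le> n \<Longrightarrow>
      system_output (A_Diag (\<Lambda> n)) (B_Diag n (V n)) (C_out n l (V n)) (D n) u (y2 n)"
  shows "\<forall>\<^sub>F n in sequentially. L2_norm (\<lambda>t. y1 n t - y2 n t)
    \<le> sqrt (6 + 50 * M\<^sup>2 / (1 - 2 powr (1 - 2 * q'))) * sqrt (real l) / real n"
proof -
  have "fourier_decay q' M u"
    using fourier_decay_mono[OF q _ u(2)] M by simp
  then obtain uhat S where uhat: "fourier_L2 u uhat"
    and decay: "AE s in lborel. S \<le> \<bar>s\<bar> \<longrightarrow> cmod (uhat s) \<le> M * \<bar>s\<bar> powr (- q')"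
    unfolding fourier_decay_def by blast
  show ?thesis
    using eventually_ge_at_top[of l] eventually_ge_at_top[of "nat \<lceil>S\<rceil>"]
  proof eventually_elim
    case (elim n)
    then have "S \<le> real n" by linarith
    with elim show ?case
      by (intro output_diff_bound[OF q' l _ _ d uhat u(1) decay y1 y2])
  qed
qed

theorem theorem1:
  shows
    "(\<forall>q > 1/2. \<forall>M > 0. \<exists>K :: real.
        \<forall>l \<ge> 1. \<forall>u V \<Lambda> (D :: nat \<Rightarrow> complex) y_DPLR y_Diag.
          u \<in> L2 \<and> L2_norm u = 1 \<and> fourier_decay q M u \<and>
          (\<forall>n \<ge> l. diagonalizes_A_H_perp n (V n) (\<Lambda> n)) \<and>
          (\<forall>n \<ge> l. system_output (A_DPLR n (V n) (\<Lambda> n)) (B_DPLR n (V n)) (C_out n l (V n)) (D n)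
                     u (y_DPLR n)) \<and>
          (\<forall>n \<ge> l. system_output (A_Diag (\<Lambda> n)) (B_Diag n (V n)) (C_out n l (V n)) (D n)
                     u (y_Diag n)) \<longrightarrow>
          (\<forall>\<^sub>F n in sequentially.
             L2_norm (\<lambda>t. y_DPLR n t - y_Diag n t) \<le> K * sqrt (real l) / real n)) \<and>
     (\<forall>q' > 1/2. \<forall>M > 0. \<exists>K :: real. \<forall>q \<ge> q'.
        \<forall>l \<ge> 1. \<forall>u V \<Lambda> (D :: nat \<Rightarrow> complex) y_DPLR y_Diag.
          u \<in> L2 \<and> L2_norm u = 1 \<and> fourier_decay q M u \<and>
          (\<forall>n \<ge> l. diagonalizes_A_H_perp n (V n) (\<Lambda> n)) \<and>
          (\<forall>n \<ge> l. system_output (A_DPLR n (V n) (\<Lambda> n)) (B_DPLR n (V n)) (C_out n l (V n)) (D n)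
                     u (y_DPLR n)) \<and>
          (\<forall>n \<ge> l. system_output (A_Diag (\<Lambda> n)) (B_Diag n (V n)) (C_out n l (V n)) (D n)
                     u (y_Diag n)) \<longrightarrow>
          (\<forall>\<^sub>F n in sequentially.
             L2_norm (\<lambda>t. y_DPLR n t - y_Diag n t) \<le> K * sqrt (real l) / real n))"
    (is "(\<forall>q > 1/2. \<forall>M > 0. \<exists>K. ?P q M K) \<and> (\<forall>q' > 1/2. \<forall>M > 0. \<exists>K. \<forall>q \<ge> q'. ?P q M K)")
proof -
  \<comment> \<open>One witness serves both halves: the first is the case \<open>q' = q\<close>, and
    in the second the witness does not mention \<open>q\<close>.\<close>
  have uniform: "?P q M (sqrt (6 + 50 * M\<^sup>2 / (1 - 2 powr (1 - 2 * q'))))"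
    if "q' > 1/2" "q' \<le> q" "M > 0" for q q' M
    by (intro allI impI, elim conjE, rule eventually_output_diff_bound[OF that]) auto
  show ?thesis
  proof (intro conjI allI impI)
    fix q M :: real
    assume "q > 1/2" "M > 0"
    then show "\<exists>K. ?P q M K"
      by (intro exI[of _ "sqrt (6 + 50 * M\<^sup>2 / (1 - 2 powr (1 - 2 * q)))"] uniform order_refl)
  next
    fix q' M :: real
    assume "q' > 1/2" "M > 0"
    then show "\<exists>K. \<forall>q \<ge> q'. ?P q M K"
      by (intro exI[of _ "sqrt (6 + 50 * M\<^sup>2 / (1 - 2 powr (1 - 2 * q')))"] allI[of "\<lambda>q. q \<ge> q' \<longrightarrow> ?P q M _"]
          impI[of "_ \<le> _"] uniform)
  qed
qed

end
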